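(* Let $(\mathcal{K},\mathcal{E})$ be the Fraïssé class of finite dimensional Banach spaces with specified bases and rational partial norms, with proper linear embeddings, described in the context. Let $G$ be its Fraïssé limit and let $\mathbb{G}$ be the completion of the normed space $G$. Then $\mathbb{G}$ is the Gurarij space; that is, $\mathbb{G}$ is a separable Banach space such that for every $\varepsilon>0$, all finite dimensional Banach spaces $E\subseteq F$ and every linear isometric embedding $\phi:E\to\mathbb{G}$ there exists a linear map $\bar\phi:F\to\mathbb{G}$ extending $\phi$ with $(1-\varepsilon)\|x\|\le\|\bar\phi(x)\|\le(1+\varepsilon)\|x\|$ for every $x\in F$.
   Context: All vector spaces are real. Let $X$ be a vector space and $A\subseteq X$ with $\mathrm{span}(A)=X$. A partial $A$-norm is a function $\|\cdot\|_A:A\to[0,\infty)$ such that for $x,y\in A$, $\alpha\in\mathbb{R}$: $\|x\|_A=0$ iff $x=0$; $\|\alpha x\|_A=|\alpha|\,\|x\|_A$ if $\alpha x\in A$; $\|x+y\|_A\le\|x\|_A+\|y\|_A$ if $x+y\in A$. It determines the function on $X$ $$\|x\|_X^A=\inf\Big\{\sum_{i=1}^n|\alpha_i|\,\|a_i\|_A:\ a_1,\dots,a_n\in A,\ \sum_{i=1}^n\alpha_i a_i=x\Big\},$$ which is a norm when $X$ is finite dimensional and $A$ is finite. The class $\mathcal{K}$ consists of all finite dimensional normed spaces $X$ with a specified basis $(x_1,\dots,x_n)$ whose norm is of the form $\|\cdot\|_X^A$, where $A\subseteq X$ is a finite set containing the basis, each element of $A$ is a linear combination of the basis elements with rational coefficients,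 and $\|\cdot\|_A:A\to\mathbb{Q}$ is a rational-valued partial $A$-norm. The class $\mathcal{E}$ consists of the proper embeddings: linear isometric embeddings between members of $\mathcal{K}$ that send elements of the specified basis of the domain to elements of the specified basis of the codomain. $(\mathcal{K},\mathcal{E})$ is a Fraïssé class: it has countably many members up to isomorphism from $\mathcal{E}$, and has the joint embedding and amalgamation properties with respect to embeddings in $\mathcal{E}$. Its Fraïssé limit $G$ is the direct limit of a sequence $X_1\to X_2\to\cdots$ of members of $\mathcal{K}$ with connecting maps in $\mathcal{E}$, characterized up to isomorphism by: (i) every $A\in\mathcal{K}$ admits an embedding into $G$ belonging to $\mathcal{E}$; (ii) for all $A,B\in\mathcal{K}$ and embeddings $\iota_A:A\to G$ and $\rho:A\to B$ belonging to $\mathcal{E}$ there is an embedding $\iota_B:B\to G$ belonging to $\mathcal{E}$ with $\iota_B\circ\rho=\iota_A$. Here an embedding $A\to G$ belongs to $\mathcal{E}$ if it is, for some $n$, an element of $\mathcal{E}$ from $A$ to $X_n$ followed by the canonical map $X_n\to G$. *)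

theory Defs
  imports "HOL-Analysis.Analysis" "HOL-Analysis.Finite_Function_Topology"
begin

definition linear_map_on :: "'a::real_vector set \<Rightarrow> ('a \<Rightarrow> 'b::real_vector) \<Rightarrow> bool"
  where "linear_map_on V f \<longleftrightarrow>
    (\<forall>x\<in>V. \<forall>y\<in>V. f (x + y) = f x + f y) \<and> (\<forall>c. \<forall>x\<in>V. f (c *\<^sub>R x) = c *\<^sub>R f x)"

definition is_norm_on :: "'a::real_vector set \<Rightarrow> ('a \<Rightarrow> real) \<Rightarrow> bool"
  where "is_norm_on V N \<longleftrightarrow>
    (\<forall>x\<in>V. 0 \<le> N x) \<and>
    (\<forall>x\<in>V. N x = 0 \<longleftrightarrow> x = 0) \<and>
    (\<forall>c. \<forall>x\<in>V. N (c *\<^sub>R x) = \<bar>c\<bar> * N x) \<and>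
    (\<forall>x\<in>V. \<forall>y\<in>V. N (x + y) \<le> N x + N y)"

definition partial_norm :: "'a::real_vector set \<Rightarrow> ('a \<Rightarrow> real) \<Rightarrow> bool"
  where "partial_norm A p \<longleftrightarrow>
    (\<forall>x\<in>A. 0 \<le> p x) \<and>
    (\<forall>x\<in>A. p x = 0 \<longleftrightarrow> x = 0) \<and>
    (\<forall>x\<in>A. \<forall>c. c *\<^sub>R x \<in> A \<longrightarrow> p (c *\<^sub>R x) = \<bar>c\<bar> * p x) \<and>
    (\<forall>x\<in>A. \<forall>y\<in>A. x + y \<in> A \<longrightarrow> p (x + y) \<le> p x + p y)"

text \<open>The empty sum (\<open>n = 0\<close>) is admitted; it only matters for \<open>x = 0\<close>, \<open>A = {}\<close>.\<close>

definition induced_norm :: "'a::real_vector set \<Rightarrow> ('a \<Rightarrow> real) \<Rightarrow> 'a \<Rightarrow> real"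
  where "induced_norm A p x =
    Inf {(\<Sum>i<n. \<bar>\<alpha> i\<bar> * p (a i)) | (n::nat) \<alpha> a.
          (\<forall>i<n. a i \<in> A) \<and> (\<Sum>i<n. \<alpha> i *\<^sub>R a i) = x}"

text \<open>A space with a specified basis: a subspace \<open>bs_space\<close> of an ambient real vector space
  whose own norm, if it has one, plays no role; \<open>bs_norm\<close> is relevant on \<open>bs_space\<close> only.
  The basis is a set, since no notion below depends on the order of its elements.\<close>

record 'a based_space =
  bs_space :: "'a set"
  bs_norm :: "'a \<Rightarrow> real"
  bs_basis :: "'a set"

definition class_K :: "'a::real_vector based_space set"
  where "class_K = {X.
    finite (bs_basis X) \<and> independent (bs_basis X) \<and> span (bs_basis X) = bs_space X \<and>
    is_norm_on (bs_space X) (bs_norm X) \<and>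
    (\<exists>A p. finite A \<and> A \<subseteq> bs_space X \<and> bs_basis X \<subseteq> A \<and>
       (\<forall>a\<in>A. \<exists>q. (\<forall>b\<in>bs_basis X. q b \<in> \<rat>) \<and> a = (\<Sum>b\<in>bs_basis X. q b *\<^sub>R b)) \<and>
       partial_norm A p \<and> (\<forall>a\<in>A. p a \<in> \<rat>) \<and>
       (\<forall>x\<in>bs_space X. bs_norm X x = induced_norm A p x))}"

definition class_E ::
    "'a::real_vector based_space \<Rightarrow> 'b::real_vector based_space \<Rightarrow> ('a \<Rightarrow> 'b) set"
  where "class_E X Y = {f.
    linear_map_on (bs_space X) f \<and>
    f ` bs_space X \<subseteq> bs_space Y \<and>
    (\<forall>x\<in>bs_space X. bs_norm Y (f x) = bs_norm X x) \<and>
    f ` bs_basis X \<subseteq> bs_basis Y}"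

text \<open>The type \<open>'g\<close>, with canonical maps \<open>j n\<close>, is the direct limit in normed spaces of
  the isometric embeddings \<open>f n\<close>: a linear isometric cocone that is jointly surjective.
  This determines \<open>'g\<close> and the \<open>j n\<close> up to a unique linear isometry.\<close>

definition is_direct_limit ::
    "(nat \<Rightarrow> 'a::real_vector based_space) \<Rightarrow> (nat \<Rightarrow> 'a \<Rightarrow> 'a) \<Rightarrow>
     (nat \<Rightarrow> 'a \<Rightarrow> 'g::real_normed_vector) \<Rightarrow> bool"
  where "is_direct_limit X f j \<longleftrightarrow>
    (\<forall>n. linear_map_on (bs_space (X n)) (j n)) \<and>
    (\<forall>n. \<forall>x\<in>bs_space (X n). norm (j n x) = bs_norm (X n) x) \<and>
    (\<forall>n. \<forall>x\<in>bs_space (X n). j (Suc n) (f n x) = j n x) \<and>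
    (\<Union>n. j n ` bs_space (X n)) = UNIV"

definition E_into_limit ::
    "(nat \<Rightarrow> 'a::real_vector based_space) \<Rightarrow> (nat \<Rightarrow> 'a \<Rightarrow> 'g::real_normed_vector) \<Rightarrow>
     'b::real_vector based_space \<Rightarrow> ('b \<Rightarrow> 'g) \<Rightarrow> bool"
  where "E_into_limit X j A \<iota> \<longleftrightarrow>
    (\<exists>n. \<exists>e\<in>class_E A (X n). \<forall>x\<in>bs_space A. \<iota> x = j n (e x))"

text \<open>All members of the class are taken inside the space of finitely supported real
  sequences. It is infinite dimensional, so every finite dimensional space with a specified
  basis has a copy there and no isomorphism type is lost.\<close>

type_synonym c00 = "nat \<Rightarrow>\<^sub>0 real"

definition is_fraisse_limit ::
    "(nat \<Rightarrow> c00 based_space) \<Rightarrow> (nat \<Rightarrow> c00 \<Rightarrow> c00) \<Rightarrow>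
     (nat \<Rightarrow> c00 \<Rightarrow> 'g::real_normed_vector) \<Rightarrow> bool"
  where "is_fraisse_limit X f j \<longleftrightarrow>
    (\<forall>n. X n \<in> class_K) \<and>
    (\<forall>n. f n \<in> class_E (X n) (X (Suc n))) \<and>
    is_direct_limit X f j \<and>
    (\<forall>A\<in>(class_K :: c00 based_space set). \<exists>\<iota>. E_into_limit X j A \<iota>) \<and>
    (\<forall>A\<in>(class_K :: c00 based_space set).
     \<forall>B\<in>(class_K :: c00 based_space set).
     \<forall>\<iota>\<^sub>A \<rho>. E_into_limit X j A \<iota>\<^sub>A \<and> \<rho> \<in> class_E A B \<longrightarrow>
       (\<exists>\<iota>\<^sub>B. E_into_limit X j B \<iota>\<^sub>B \<and> (\<forall>x\<in>bs_space A. \<iota>\<^sub>B (\<rho> x) = \<iota>\<^sub>A x)))"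

definition is_completion :: "('g::real_normed_vector \<Rightarrow> 'c::banach) \<Rightarrow> bool"
  where "is_completion \<kappa> \<longleftrightarrow>
    linear \<kappa> \<and> (\<forall>x. norm (\<kappa> x) = norm x) \<and> closure (range \<kappa>) = UNIV"

end

theory Submission
  imports Defs
begin

text \<open>Let \<open>\<phi>\<close> be an isometry of \<open>E\<close> into the completion and \<open>F\<close> a finite dimensional space above \<open>E\<close>.
  The Fraisse limit only realises extensions that respect specified bases and rational norms, so the
  problem is first perturbed into the class and the solution is corrected afterwards.

  Vectors with rational coordinates in the stages \<open>X n\<close> are dense in the completion. Hence a basis
  of \<open>E\<close> can be moved slightly from its image under \<open>\<phi>\<close> to rational vectors of a single stage
  \<open>V = X n\<close>, which defines an almost isometric map \<open>T\<close> from \<open>E\<close> to \<open>V\<close>. The lemma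
  \<open>approximate_amalgamation\<close> glues \<open>V\<close> and \<open>F\<close> along \<open>T\<close>: it gives a member \<open>W\<close> of the class that contains
  \<open>V\<close> isometrically, with the basis of \<open>V\<close> as part of its basis, and an almost isometric map from
  \<open>F\<close> to \<open>W\<close> that extends \<open>T\<close>. The extension property of the limit embeds \<open>W\<close> over \<open>V\<close>. The composite
  from \<open>F\<close> into the completion is almost isometric and close to \<open>\<phi>\<close> on the basis of \<open>E\<close>; redefining it as
  \<open>\<phi>\<close> there changes it by a small amount relative to the norm, since in finite dimensions
  coordinates are bounded by the norm (\<open>coordinates_bounded\<close>).

  For the amalgam to belong to the class, its norm must come from a finite rational partial norm.
  Triangle inequalities between prescribed rational weights are hard to arrange by hand, but they
  need not be: any finite set of rational vectors with positive rational weights on the nonzero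
  vectors induces a norm that takes rational values on rational vectors, and the restriction of
  this norm to the generators is a rational partial norm that induces the same norm
  (\<open>class_K_induced_norm\<close>). Rationality holds because the infimum in the definition
  is attained by a combination with linearly independent support (\<open>induced_norm_attained\<close>), whose
  coefficients solve a rational linear system uniquely (\<open>representation_rational\<close>).\<close>

section \<open>Rational vectors\<close>

definition rational_span :: "'a::real_vector set \<Rightarrow> 'a set"
  where "rational_span B = {x. \<exists>q. (\<forall>b\<in>B. q b \<in> \<rat>) \<and> x = (\<Sum>b\<in>B. q b *\<^sub>R b)}"

lemma rational_spanI:
  "(\<And>b. b \<in> B \<Longrightarrow> q b \<in> \<rat>) \<Longrightarrow> x = (\<Sum>b\<in>B. q b *\<^sub>R b) \<Longrightarrow> x \<in> rational_span B"
  unfolding rational_span_def by blast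

lemma rational_spanE:
  assumes "x \<in> rational_span B"
  obtains q where "\<And>b. b \<in> B \<Longrightarrow> q b \<in> \<rat>" "x = (\<Sum>b\<in>B. q b *\<^sub>R b)"
  using assms unfolding rational_span_def by blast

lemma rational_span_subset_span: "rational_span B \<subseteq> span B"
proof
  fix x assume "x \<in> rational_span B"
  then obtain q where "x = (\<Sum>b\<in>B. q b *\<^sub>R b)" by (blast elim: rational_spanE)
  then show "x \<in> span B" by (auto intro: span_sum span_scale span_base)
qed

lemma rational_span_zero: "0 \<in> rational_span B"
  by (rule rational_spanI[where q="\<lambda>_. 0"]) auto

lemma rational_span_add:
  assumes "x \<in> rational_span B" "y \<in> rational_span B"
  shows "x + y \<in> rational_span B"
proof -
  obtain q where q: "\<And>b. b \<in> B \<Longrightarrow> q b \<in> \<rat>" "x = (\<Sum>b\<in>B. q b *\<^sub>R b)"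
    using assms(1) by (blast elim: rational_spanE)
  obtain r where r: "\<And>b. b \<in> B \<Longrightarrow> r b \<in> \<rat>" "y = (\<Sum>b\<in>B. r b *\<^sub>R b)"
    using assms(2) by (blast elim: rational_spanE)
  show ?thesis
    by (rule rational_spanI[where q="\<lambda>b. q b + r b"])
      (auto simp: q r scaleR_left_distrib sum.distrib)
qed

lemma rational_span_scale:
  assumes "c \<in> \<rat>" "x \<in> rational_span B"
  shows "c *\<^sub>R x \<in> rational_span B"
proof -
  obtain q where q: "\<And>b. b \<in> B \<Longrightarrow> q b \<in> \<rat>" "x = (\<Sum>b\<in>B. q b *\<^sub>R b)"
    using assms(2) by (blast elim: rational_spanE)
  show ?thesis
    by (rule rational_spanI[where q="\<lambda>b. c * q b"])
      (auto simp: q assms(1) scaleR_sum_right)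
qed

lemma rational_span_sum:
  "(\<And>i. i \<in> I \<Longrightarrow> q i \<in> \<rat>) \<Longrightarrow> (\<And>i. i \<in> I \<Longrightarrow> v i \<in> rational_span B) \<Longrightarrow>
    (\<Sum>i\<in>I. q i *\<^sub>R v i) \<in> rational_span B"
  by (induction I rule: infinite_finite_induct)
    (auto simp: rational_span_zero intro: rational_span_add rational_span_scale)

lemma rational_span_base:
  assumes "finite B" "b \<in> B" shows "b \<in> rational_span B"
proof (rule rational_spanI[where q="\<lambda>x. if x = b then 1 else 0"])
  show "b = (\<Sum>x\<in>B. (if x = b then 1 else 0) *\<^sub>R x)"
    using assms by (simp add: if_distrib[of "\<lambda>c. c *\<^sub>R _"] cong: if_cong)
qed auto

lemma rational_span_mono:
  assumes "finite B" "A \<subseteq> B" shows "rational_span A \<subseteq> rational_span B"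
proof
  fix x assume "x \<in> rational_span A"
  then obtain q where q: "\<And>b. b \<in> A \<Longrightarrow> q b \<in> \<rat>" "x = (\<Sum>b\<in>A. q b *\<^sub>R b)"
    by (blast elim: rational_spanE)
  have "b \<in> rational_span B" if "b \<in> A" for b
    using that assms rational_span_base by blast
  then show "x \<in> rational_span B"
    unfolding q(2) using q(1) by (intro rational_span_sum) auto
qed

lemma rational_linear_image:
  assumes "linear f" "\<And>b. b \<in> B \<Longrightarrow> f b \<in> rational_span C" "x \<in> rational_span B"
  shows "f x \<in> rational_span C"
proof -
  obtain q where q: "\<And>b. b \<in> B \<Longrightarrow> q b \<in> \<rat>" "x = (\<Sum>b\<in>B. q b *\<^sub>R b)"
    using assms(3) by (blast elim: rational_spanE)
  have "f x = (\<Sum>b\<in>B. q b *\<^sub>R f b)"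
    unfolding q(2) using assms(1) by (simp add: linear_sum linear_scale)
  then show ?thesis using rational_span_sum[of B q f C] q(1) assms(2) by simp
qed

lemma representation_rational_span:
  assumes "finite B" "independent B" "x \<in> rational_span B"
  shows "representation B x b \<in> \<rat>"
proof (cases "b \<in> B")
  case True
  obtain q where q: "\<And>b. b \<in> B \<Longrightarrow> q b \<in> \<rat>" "x = (\<Sum>b\<in>B. q b *\<^sub>R b)"
    using assms(3) by (blast elim: rational_spanE)
  have "representation B x = (\<lambda>v. \<Sum>c\<in>B. q c * (if v = c then 1 else 0))"
    unfolding q(2) using assms(2)
    by (subst representation_sum)
      (auto simp: representation_scale span_scale span_base representation_basis intro!: ext sum.cong)
  then have "representation B x b = q b"
    using assms(1) True by (simp add: if_distrib cong: if_cong)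
  then show ?thesis using q(1) True by simp
next
  case False
  then have "representation B x b = 0" using representation_ne_zero by blast
  then show ?thesis by simp
qed

text \<open>The set \<open>{1}\<close> is independent over the rationals, so the identity of \<open>\<rat>\<close> extends to a
  \<open>\<rat>\<close>-linear map on all of \<open>\<real>\<close>. It serves to transport real solutions of rational linear
  systems to rational ones.\<close>

lemma rational_retraction_exists:
  obtains h :: "real \<Rightarrow> real"
  where "\<And>x y. h (x + y) = h x + h y" "\<And>q x. q \<in> \<rat> \<Longrightarrow> h (q * x) = q * h x"
    "\<And>x. h x \<in> \<rat>" "h 1 = 1"
proof -
  let ?s = "\<lambda>(q::rat) (x::real). of_rat q * x"
  interpret V: vector_space ?s
    by unfold_locales (auto simp: algebra_simps of_rat_add of_rat_mult)
  interpret Q: vector_space "(*) :: rat \<Rightarrow> rat \<Rightarrow> rat"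
    by unfold_locales (auto simp: algebra_simps)
  interpret P: vector_space_pair ?s "(*) :: rat \<Rightarrow> rat \<Rightarrow> rat" ..
  have "V.independent {1}" by simp
  from P.linear_independent_extend[OF this, of "\<lambda>_. 1"] obtain g
    where g: "Vector_Spaces.linear ?s (*) g" "g 1 = (1::rat)" by auto
  interpret g: Vector_Spaces.linear ?s "(*)" g by (rule g(1))
  show thesis
  proof (rule that[of "\<lambda>x. of_rat (g x)"])
    show "of_rat (g (q * x)) = q * of_rat (g x)" if "q \<in> \<rat>" for q x :: real
      using that by (auto simp: Rats_def g.scale of_rat_mult)
  qed (auto simp: g.add of_rat_add g(2))
qed

text \<open>A linear system with rational data that is solvable over the reals is solvable over the
  rationals: applying a \<open>\<rat>\<close>-linear retraction \<open>\<real> \<rightarrow> \<rat>\<close> to a real solution gives a rational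
  one. Independence of \<open>D\<close> makes the solution unique, so it was rational to begin with.\<close>

lemma representation_rational:
  assumes B: "finite B" "independent B" and D: "finite D" "independent D" "D \<subseteq> rational_span B"
    and x: "x \<in> rational_span B" "x \<in> span D"
  shows "representation D x d \<in> \<rat>"
proof (cases "d \<in> D")
  case True
  obtain h :: "real \<Rightarrow> real" where h: "\<And>x y. h (x + y) = h x + h y"
    "\<And>q x. q \<in> \<rat> \<Longrightarrow> h (q * x) = q * h x" "\<And>x. h x \<in> \<rat>" "h 1 = 1"
    using rational_retraction_exists by blast
  have h0: "h 0 = 0" using h(2)[of 0 0] by simp
  have hsum: "h (sum g I) = (\<Sum>i\<in>I. h (g i))" for g and I :: "'a set"
    by (induction I rule: infinite_finite_induct) (auto simp: h h0)
  have hq: "h q = q" if "q \<in> \<rat>" for q using h(2)[OF that, of 1] h(4) by simp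
  define r where "r = representation D x"
  have span: "v \<in> span B" if "v \<in> rational_span B" for v
    using that rational_span_subset_span by blast
  have xr: "x = (\<Sum>d\<in>D. r d *\<^sub>R d)"
    unfolding r_def using sum_representation_eq[OF D(2) x(2) D(1)] by simp
  have Dspan: "v \<in> span B" if "v \<in> D" for v using that D(3) span by blast
  have rep: "representation B (\<Sum>d\<in>D. c d *\<^sub>R d) b = (\<Sum>d\<in>D. c d * representation B d b)" for c b
    using B(2) Dspan by (subst representation_sum) (auto simp: representation_scale span_scale)
  have "representation B x b = representation B (\<Sum>d\<in>D. h (r d) *\<^sub>R d) b" for b
  proof -
    have "representation B x b = h (representation B x b)"
      using hq[OF representation_rational_span[OF B x(1)]] by simp
    also have "\<dots> = (\<Sum>d\<in>D. h (representation B d b * r d))"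
      by (subst xr) (simp add: rep hsum mult.commute)
    also have "\<dots> = (\<Sum>d\<in>D. representation B d b * h (r d))"
      using D(3) by (intro sum.cong h(2) representation_rational_span[OF B]) auto
    finally show ?thesis by (simp add: rep mult.commute)
  qed
  then have eq: "representation B x = representation B (\<Sum>d\<in>D. h (r d) *\<^sub>R d)" by auto
  have "(\<Sum>d\<in>D. h (r d) *\<^sub>R d) \<in> span B" by (intro span_sum span_scale Dspan)
  then have "x = (\<Sum>d\<in>D. h (r d) *\<^sub>R d)"
    using eq sum_representation_eq[OF B(2) _ B(1)] span[OF x(1)] by (metis order_refl)
  then have "(\<Sum>d\<in>D. (r d - h (r d)) *\<^sub>R d) = 0"
    using xr by (simp add: scaleR_left_diff_distrib sum_subtractf)
  then have "r d - h (r d) = 0"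
    using independentD[OF D(2) D(1) order_refl, of "\<lambda>d. r d - h (r d)"] True by blast
  then show ?thesis using h(3)[of "r d"] by (simp add: r_def)
next
  case False
  then have "representation D x d = 0" using representation_ne_zero by blast
  then show ?thesis by simp
qed

section \<open>Norms induced by finite weighted sets\<close>

lemma span_finiteE:
  assumes "finite A" "x \<in> span A"
  obtains c where "(\<Sum>a\<in>A. c a *\<^sub>R a) = x"
  using assms by (auto simp: span_finite)

text \<open>The induced norm is defined by indexed families, in which a generator may occur
  repeatedly. For a finite set of generators, collecting repetitions does not raise
  the cost, so it suffices to consider one coefficient per generator.\<close>

lemma indexed_combination_collect:
  fixes A :: "'a::real_vector set"
  assumes "finite A" "\<And>a. a \<in> A \<Longrightarrow> 0 \<le> p a" "\<forall>i<n. a i \<in> A"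
  shows "\<exists>c. (\<Sum>x\<in>A. c x *\<^sub>R x) = (\<Sum>i<n. \<alpha> i *\<^sub>R a i) \<and>
    (\<Sum>x\<in>A. \<bar>c x\<bar> * p x) \<le> (\<Sum>i<(n::nat). \<bar>\<alpha> i\<bar> * p (a i))"
  using assms(3)
proof (induction n)
  case 0
  have "(\<Sum>x\<in>A. (\<lambda>_. 0) x *\<^sub>R x) = 0" by (rule sum.neutral) simp
  then show ?case by (intro exI[of _ "\<lambda>_. 0"]) simp
next
  case (Suc n)
  then obtain c where c: "(\<Sum>x\<in>A. c x *\<^sub>R x) = (\<Sum>i<n. \<alpha> i *\<^sub>R a i)"
    "(\<Sum>x\<in>A. \<bar>c x\<bar> * p x) \<le> (\<Sum>i<n. \<bar>\<alpha> i\<bar> * p (a i))" by auto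
  have an: "a n \<in> A" using Suc.prems by auto
  define d where "d x = c x + (if x = a n then \<alpha> n else 0)" for x
  have "(\<Sum>x\<in>A. d x *\<^sub>R x) = (\<Sum>x\<in>A. c x *\<^sub>R x) + (\<Sum>x\<in>A. if x = a n then \<alpha> n *\<^sub>R x else 0)"
    unfolding d_def sum.distrib[symmetric]
    by (intro sum.cong) (auto simp: scaleR_left_distrib)
  moreover have "(\<Sum>x\<in>A. \<bar>d x\<bar> * p x) \<le>
      (\<Sum>x\<in>A. \<bar>c x\<bar> * p x + (if x = a n then \<bar>\<alpha> n\<bar> * p x else 0))"
  proof (rule sum_mono)
    fix x assume "x \<in> A"
    then have "\<bar>c x + \<alpha> n\<bar> * p x \<le> (\<bar>c x\<bar> + \<bar>\<alpha> n\<bar>) * p x"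
      using assms(2) by (intro mult_right_mono) auto
    then show "\<bar>d x\<bar> * p x \<le> \<bar>c x\<bar> * p x + (if x = a n then \<bar>\<alpha> n\<bar> * p x else 0)"
      by (auto simp: d_def distrib_right)
  qed
  moreover have "(\<Sum>x\<in>A. \<bar>c x\<bar> * p x + (if x = a n then \<bar>\<alpha> n\<bar> * p x else 0)) =
      (\<Sum>x\<in>A. \<bar>c x\<bar> * p x) + \<bar>\<alpha> n\<bar> * p (a n)"
    unfolding sum.distrib using an assms(1) by simp
  ultimately show ?case
    using c an assms(1) by (intro exI[of _ d]) auto
qed

lemma collected_combination_index:
  fixes A :: "'a::real_vector set"
  assumes "finite A"
  shows "\<exists>(n::nat) \<alpha> a. (\<forall>i<n. a i \<in> A) \<and> (\<Sum>i<n. \<alpha> i *\<^sub>R a i) = (\<Sum>x\<in>A. c x *\<^sub>R x) \<and>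
    (\<Sum>i<n. \<bar>\<alpha> i\<bar> * p (a i)) = (\<Sum>x\<in>A. \<bar>c x\<bar> * p x)"
proof -
  obtain h where h: "bij_betw h {0..<card A} A"
    using ex_bij_betw_nat_finite[OF assms] by blast
  then have h': "bij_betw h {..<card A} A" by (simp add: lessThan_atLeast0)
  show ?thesis
    using sum.reindex_bij_betw[OF h', of "\<lambda>x. c x *\<^sub>R x"]
      sum.reindex_bij_betw[OF h', of "\<lambda>x. \<bar>c x\<bar> * p x"] bij_betwE[OF h']
    by (intro exI[of _ "card A"] exI[of _ "\<lambda>i. c (h i)"] exI[of _ h]) auto
qed

lemma induced_norm_le:
  assumes "finite A" "\<And>a. a \<in> A \<Longrightarrow> 0 \<le> p a"
  shows "induced_norm A p (\<Sum>a\<in>A. c a *\<^sub>R a) \<le> (\<Sum>a\<in>A. \<bar>c a\<bar> * p a)"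
  unfolding induced_norm_def
proof (rule cInf_lower)
  obtain n \<alpha> a where 1: "\<forall>i<n::nat. a i \<in> A"
    "(\<Sum>i<n. \<alpha> i *\<^sub>R a i) = (\<Sum>x\<in>A. c x *\<^sub>R x)"
    "(\<Sum>i<n. \<bar>\<alpha> i\<bar> * p (a i)) = (\<Sum>x\<in>A. \<bar>c x\<bar> * p x)"
    using collected_combination_index[OF assms(1), of c p] by blast
  show "(\<Sum>a\<in>A. \<bar>c a\<bar> * p a) \<in> {(\<Sum>i<n. \<bar>\<alpha> i\<bar> * p (a i)) | (n::nat) \<alpha> a.
          (\<forall>i<n. a i \<in> A) \<and> (\<Sum>i<n. \<alpha> i *\<^sub>R a i) = (\<Sum>a\<in>A. c a *\<^sub>R a)}"
    using 1 by (intro CollectI exI[of _ n] exI[of _ \<alpha>] exI[of _ a]) auto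
  show "bdd_below {(\<Sum>i<n. \<bar>\<alpha> i\<bar> * p (a i)) | (n::nat) \<alpha> a.
          (\<forall>i<n. a i \<in> A) \<and> (\<Sum>i<n. \<alpha> i *\<^sub>R a i) = (\<Sum>a\<in>A. c a *\<^sub>R a)}"
    using assms(2) by (intro bdd_belowI[of _ 0]) (auto intro!: sum_nonneg)
qed

lemma induced_norm_ge:
  assumes "finite A" "\<And>a. a \<in> A \<Longrightarrow> 0 \<le> p a" "x \<in> span A"
    and "\<And>c. (\<Sum>a\<in>A. c a *\<^sub>R a) = x \<Longrightarrow> m \<le> (\<Sum>a\<in>A. \<bar>c a\<bar> * p a)"
  shows "m \<le> induced_norm A p x"
  unfolding induced_norm_def
proof (rule cInf_greatest)
  obtain c where "(\<Sum>a\<in>A. c a *\<^sub>R a) = x" using span_finiteE[OF assms(1,3)] by blast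
  then show "{(\<Sum>i<n. \<bar>\<alpha> i\<bar> * p (a i)) | (n::nat) \<alpha> a.
          (\<forall>i<n. a i \<in> A) \<and> (\<Sum>i<n. \<alpha> i *\<^sub>R a i) = x} \<noteq> {}"
    using collected_combination_index[OF assms(1), of c p] by blast
next
  fix y assume "y \<in> {(\<Sum>i<n. \<bar>\<alpha> i\<bar> * p (a i)) | (n::nat) \<alpha> a.
          (\<forall>i<n. a i \<in> A) \<and> (\<Sum>i<n. \<alpha> i *\<^sub>R a i) = x}"
  then obtain n \<alpha> a where 1: "y = (\<Sum>i<n. \<bar>\<alpha> i\<bar> * p (a i))" "\<forall>i<n::nat. a i \<in> A"
    "(\<Sum>i<n. \<alpha> i *\<^sub>R a i) = x" by blast
  obtain c where "(\<Sum>x\<in>A. c x *\<^sub>R x) = x" "(\<Sum>x\<in>A. \<bar>c x\<bar> * p x) \<le> y"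
    using indexed_combination_collect[of A p n a \<alpha>, OF assms(1,2) 1(2)] 1 by auto
  with assms(4) show "m \<le> y" by force
qed

text \<open>Caratheodory's argument: along a linear dependency among the vectors in use, the cost
  is affine as long as no coefficient changes sign, so one can move in a direction in which the
  cost does not increase until some coefficient vanishes.\<close>

lemma reduce_support:
  fixes A :: "'a::real_vector set"
  assumes A: "finite A" "\<And>a. a \<in> A \<Longrightarrow> 0 \<le> p a"
  shows "\<exists>D\<subseteq>A. independent D \<and> (\<Sum>a\<in>A. c a *\<^sub>R a) \<in> span D \<and>
    (\<Sum>d\<in>D. \<bar>representation D (\<Sum>a\<in>A. c a *\<^sub>R a) d\<bar> * p d) \<le> (\<Sum>a\<in>A. \<bar>c a\<bar> * p a)"
proof (induction "card {a\<in>A. c a \<noteq> 0}" arbitrary: c rule: less_induct)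
  case less
  define D where "D = {a\<in>A. c a \<noteq> 0}"
  define x where "x = (\<Sum>a\<in>A. c a *\<^sub>R a)"
  have D: "finite D" "D \<subseteq> A" using A(1) by (auto simp: D_def)
  have xD: "x = (\<Sum>a\<in>D. c a *\<^sub>R a)"
    unfolding x_def using A(1) by (intro sum.mono_neutral_right) (auto simp: D_def)
  have costD: "(\<Sum>a\<in>A. \<bar>c a\<bar> * p a) = (\<Sum>a\<in>D. \<bar>c a\<bar> * p a)"
    using A(1) by (intro sum.mono_neutral_right) (auto simp: D_def)
  show ?case
  proof (cases "independent D")
    case True
    have xs: "x \<in> span D" unfolding xD by (intro span_sum span_scale span_base)
    have "representation D x = (\<lambda>d. if d \<in> D then c d else 0)"
    proof (rule representation_eqI[OF True xs])
      have "{b. (if b \<in> D then c b else 0) \<noteq> 0} = D" by (auto simp: D_def)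
      then show "finite {b. (if b \<in> D then c b else 0) \<noteq> 0}"
        "(\<Sum>b | (if b \<in> D then c b else 0) \<noteq> 0. (if b \<in> D then c b else 0) *\<^sub>R b) = x"
        using D(1) by (simp_all add: xD)
    qed (auto split: if_splits)
    then show ?thesis
      using True xs D by (intro exI[of _ D]) (auto simp: x_def[symmetric] costD)
  next
    case False
    then obtain g0 where g0: "\<exists>v\<in>D. g0 v \<noteq> 0" "(\<Sum>v\<in>D. g0 v *\<^sub>R v) = 0"
      using D(1) by (auto simp: dependent_finite)
    define slope where "slope g = (\<Sum>v\<in>D. sgn (c v) * g v * p v)" for g
    \<comment> \<open>The sign of the dependency is chosen such that the cost does not increase and some
      coefficient moves towards zero.\<close>
    have "\<exists>g. (\<Sum>v\<in>D. g v *\<^sub>R v) = 0 \<and> slope g \<le> 0 \<and> (\<exists>v\<in>D. sgn (c v) * g v < 0)"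
    proof -
      have neg: "(\<Sum>v\<in>D. (- g0 v) *\<^sub>R v) = 0" "slope (\<lambda>v. - g0 v) = - slope g0"
        using g0(2) by (simp_all add: sum_negf slope_def)
      have down: "\<exists>v\<in>D. sgn (c v) * g v < 0" if "slope g < 0" for g
      proof (rule ccontr)
        assume "\<not> ?thesis"
        then have "0 \<le> sgn (c v) * g v * p v" if "v \<in> D" for v
          using that A(2) D(2) mult_nonneg_nonneg[of "sgn (c v) * g v" "p v"]
          by (auto simp: not_less)
        then have "0 \<le> slope g" unfolding slope_def by (intro sum_nonneg)
        with that show False by simp
      qed
      consider "slope g0 < 0" | "slope g0 > 0" | "slope g0 = 0" by linarith
      then show ?thesis
      proof cases
        case 1
        then show ?thesis using g0(2) down by (intro exI[of _ g0]) auto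
      next
        case 2
        then show ?thesis using neg down[of "\<lambda>v. - g0 v"]
          by (intro exI[of _ "\<lambda>v. - g0 v"]) auto
      next
        case 3
        obtain v where v: "v \<in> D" "g0 v \<noteq> 0" using g0(1) by blast
        then have "sgn (c v) * g0 v \<noteq> 0" by (auto simp: D_def sgn_zero_iff)
        then consider "sgn (c v) * g0 v < 0" | "sgn (c v) * (- g0 v) < 0" by fastforce
        then show ?thesis
        proof cases
          case 1
          then show ?thesis using 3 g0(2) v(1) by (intro exI[of _ g0]) auto
        next
          case 2
          then show ?thesis using 3 neg v(1) by (intro exI[of _ "\<lambda>v. - g0 v"]) auto
        qed
      qed
    qed
    then obtain g where g: "(\<Sum>v\<in>D. g v *\<^sub>R v) = 0" "slope g \<le> 0"
      and ex: "\<exists>v\<in>D. sgn (c v) * g v < 0" by blast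
    \<comment> \<open>The step length \<open>t\<close> is the first time at which a coefficient vanishes.\<close>
    define N where "N = {v\<in>D. sgn (c v) * g v < 0}"
    define t where "t = Min ((\<lambda>v. \<bar>c v\<bar> / - (sgn (c v) * g v)) ` N)"
    have N: "finite N" "N \<noteq> {}" using D(1) ex by (auto simp: N_def)
    have tle: "t \<le> \<bar>c v\<bar> / - (sgn (c v) * g v)" if "v \<in> N" for v
      unfolding t_def using N that by (intro Min_le) auto
    have "t \<in> (\<lambda>v. \<bar>c v\<bar> / - (sgn (c v) * g v)) ` N"
      unfolding t_def using N by (intro Min_in) auto
    then obtain v0 where v0: "v0 \<in> N" "t = \<bar>c v0\<bar> / - (sgn (c v0) * g v0)" by blast
    have t0: "0 \<le> t" using v0 by (auto simp: N_def intro!: divide_nonneg_neg)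
    define c' where "c' v = (if v \<in> D then c v + t * g v else 0)" for v
    have c'v0: "c' v0 = 0"
    proof -
      have "v0 \<in> D" "sgn (c v0) * g v0 < 0" using v0(1) by (auto simp: N_def)
      then show ?thesis unfolding c'_def v0(2)
        by (cases "c v0 > 0") (auto simp: sgn_if field_simps split: if_splits)
    qed
    have abs: "\<bar>c' v\<bar> = \<bar>c v\<bar> + t * (sgn (c v) * g v)" if v: "v \<in> D" for v
    proof -
      have nn: "0 \<le> \<bar>c v\<bar> + t * (sgn (c v) * g v)"
      proof (cases "v \<in> N")
        case True
        then show ?thesis using tle[OF True] by (auto simp: N_def field_simps)
      next
        case False
        then show ?thesis using v t0 by (auto simp: N_def not_less)
      qed
      have "c' v = sgn (c v) * (\<bar>c v\<bar> + t * (sgn (c v) * g v))" "\<bar>sgn (c v)\<bar> = 1"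
        using v by (auto simp: c'_def D_def sgn_if algebra_simps)
      then show ?thesis using nn by (simp add: abs_mult)
    qed
    have supp: "{a\<in>A. c' a \<noteq> 0} \<subset> D"
      using c'v0 v0(1) by (auto simp: c'_def N_def)
    have c'A: "(\<Sum>a\<in>A. c' a *\<^sub>R a) = x"
    proof -
      have "(\<Sum>a\<in>A. c' a *\<^sub>R a) = (\<Sum>a\<in>D. c' a *\<^sub>R a)"
        using A(1) D by (intro sum.mono_neutral_right) (auto simp: c'_def)
      also have "\<dots> = (\<Sum>a\<in>D. c a *\<^sub>R a) + t *\<^sub>R (\<Sum>a\<in>D. g a *\<^sub>R a)"
        by (simp add: c'_def scaleR_left_distrib sum.distrib scaleR_sum_right)
      finally show ?thesis using g(1) xD by simp
    qed
    have cost: "(\<Sum>a\<in>A. \<bar>c' a\<bar> * p a) \<le> (\<Sum>a\<in>A. \<bar>c a\<bar> * p a)"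
    proof -
      have "(\<Sum>a\<in>A. \<bar>c' a\<bar> * p a) = (\<Sum>a\<in>D. \<bar>c' a\<bar> * p a)"
        using A(1) D by (intro sum.mono_neutral_right) (auto simp: c'_def)
      also have "\<dots> = (\<Sum>a\<in>D. (\<bar>c a\<bar> + t * (sgn (c a) * g a)) * p a)"
        using abs by (intro sum.cong) auto
      also have "\<dots> = (\<Sum>a\<in>D. \<bar>c a\<bar> * p a) + t * slope g"
        by (simp add: slope_def distrib_right sum.distrib sum_distrib_left mult.assoc)
      also have "\<dots> \<le> (\<Sum>a\<in>D. \<bar>c a\<bar> * p a)"
        using mult_nonneg_nonpos[OF t0 g(2)] by simp
      finally show ?thesis using costD by simp
    qed
    have "card {a\<in>A. c' a \<noteq> 0} < card {a\<in>A. c a \<noteq> 0}"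
      using psubset_card_mono[OF D(1) supp] by (simp add: D_def)
    from less[OF this] show ?thesis unfolding c'A x_def using cost order.trans by blast
  qed
qed

text \<open>By the previous reduction only the finitely many independent subsets of the generators
  compete, and each of them offers exactly one combination; so the infimum is a minimum.\<close>

lemma induced_norm_attained:
  assumes A: "finite A" "\<And>a. a \<in> A \<Longrightarrow> 0 \<le> p a" and x: "x \<in> span A"
  obtains D where "D \<subseteq> A" "independent D" "x \<in> span D"
    "induced_norm A p x = (\<Sum>d\<in>D. \<bar>representation D x d\<bar> * p d)"
proof -
  define cost where "cost D = (\<Sum>d\<in>D. \<bar>representation D x d\<bar> * p d)" for D
  define \<D> where "\<D> = {D. D \<subseteq> A \<and> independent D \<and> x \<in> span D}"
  have fin: "finite \<D>" using A(1) by (auto simp: \<D>_def)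
  obtain c where c: "(\<Sum>a\<in>A. c a *\<^sub>R a) = x" using span_finiteE[OF A(1) x] by blast
  have red: "\<exists>D\<in>\<D>. cost D \<le> (\<Sum>a\<in>A. \<bar>c a\<bar> * p a)" if "(\<Sum>a\<in>A. c a *\<^sub>R a) = x" for c
    using reduce_support[of A p c, OF A] that by (auto simp: cost_def \<D>_def)
  have ne: "\<D> \<noteq> {}" using red[OF c] by auto
  have "Min (cost ` \<D>) \<in> cost ` \<D>" using fin ne by (intro Min_in) auto
  then obtain D where D: "D \<in> \<D>" "cost D = Min (cost ` \<D>)" by auto
  have min: "cost D \<le> cost D'" if "D' \<in> \<D>" for D' using D(2) fin that by simp
  have DA: "finite D" "D \<subseteq> A" using D(1) A(1) finite_subset by (auto simp: \<D>_def)
  have "induced_norm A p x = cost D"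
  proof (rule antisym)
    show "cost D \<le> induced_norm A p x"
    proof (rule induced_norm_ge[OF A x])
      fix c assume "(\<Sum>a\<in>A. c a *\<^sub>R a) = x"
      then show "cost D \<le> (\<Sum>a\<in>A. \<bar>c a\<bar> * p a)" using red min order.trans by blast
    qed
    let ?r = "representation D x"
    have r0: "?r a = 0" if "a \<notin> D" for a using that representation_ne_zero by blast
    have "(\<Sum>a\<in>A. ?r a *\<^sub>R a) = x"
      using D(1) A(1) by (intro sum_representation_eq) (auto simp: \<D>_def)
    moreover have "(\<Sum>a\<in>A. \<bar>?r a\<bar> * p a) = cost D"
      unfolding cost_def using A(1) DA r0 by (intro sum.mono_neutral_right) auto
    ultimately show "induced_norm A p x \<le> cost D"
      using induced_norm_le[of A p ?r, OF A] by simp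
  qed
  with D(1) show thesis by (intro that[of D]) (auto simp: \<D>_def cost_def)
qed

text \<open>The minimal cost is attained on an independent set of rational vectors, where the
  coefficients are rational as the unique solution of a rational linear system.\<close>

lemma induced_norm_rational:
  assumes B: "finite B" "independent B" and A: "finite A" "A \<subseteq> rational_span B"
    and p: "\<And>a. a \<in> A \<Longrightarrow> 0 \<le> p a" "\<And>a. a \<in> A \<Longrightarrow> p a \<in> \<rat>"
    and x: "x \<in> span A" "x \<in> rational_span B"
  shows "induced_norm A p x \<in> \<rat>"
proof -
  obtain D where D: "D \<subseteq> A" "independent D" "x \<in> span D"
    "induced_norm A p x = (\<Sum>d\<in>D. \<bar>representation D x d\<bar> * p d)"
    using induced_norm_attained[of A p, OF A(1) p(1) x(1)] by blast
  have "finite D" "D \<subseteq> rational_span B" using D(1) A finite_subset by auto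
  then have "representation D x d \<in> \<rat>" for d
    using representation_rational[OF B _ D(2) _ x(2) D(3)] by blast
  then show ?thesis unfolding D(4) using D(1) p(2)
    by (intro Rats_sum) auto
qed

lemma induced_norm_attained_combination:
  assumes A: "finite A" "\<And>a. a \<in> A \<Longrightarrow> 0 \<le> p a" and x: "x \<in> span A"
  obtains c where "(\<Sum>a\<in>A. c a *\<^sub>R a) = x" "induced_norm A p x = (\<Sum>a\<in>A. \<bar>c a\<bar> * p a)"
proof -
  obtain D where D: "D \<subseteq> A" "independent D" "x \<in> span D"
    "induced_norm A p x = (\<Sum>d\<in>D. \<bar>representation D x d\<bar> * p d)"
    using induced_norm_attained[of A p, OF A x] by blast
  let ?r = "representation D x"
  have r0: "?r a = 0" if "a \<notin> D" for a using that representation_ne_zero by blast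
  show thesis
  proof (rule that[of ?r])
    show "(\<Sum>a\<in>A. ?r a *\<^sub>R a) = x" using D A(1) by (intro sum_representation_eq) auto
    show "induced_norm A p x = (\<Sum>a\<in>A. \<bar>?r a\<bar> * p a)"
      unfolding D(4) using A(1) D(1) r0 by (intro sum.mono_neutral_left) auto
  qed
qed

lemma induced_norm_nonneg:
  assumes "finite A" "\<And>a. a \<in> A \<Longrightarrow> 0 \<le> p a" "x \<in> span A"
  shows "0 \<le> induced_norm A p x"
  using assms by (intro induced_norm_ge) (auto intro!: sum_nonneg)

lemma induced_norm_triangle:
  assumes A: "finite A" "\<And>a. a \<in> A \<Longrightarrow> 0 \<le> p a" and x: "x \<in> span A" and y: "y \<in> span A"
  shows "induced_norm A p (x + y) \<le> induced_norm A p x + induced_norm A p y"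
proof -
  obtain c where c: "(\<Sum>a\<in>A. c a *\<^sub>R a) = x" "induced_norm A p x = (\<Sum>a\<in>A. \<bar>c a\<bar> * p a)"
    using induced_norm_attained_combination[of A p, OF A x] by blast
  obtain d where d: "(\<Sum>a\<in>A. d a *\<^sub>R a) = y" "induced_norm A p y = (\<Sum>a\<in>A. \<bar>d a\<bar> * p a)"
    using induced_norm_attained_combination[of A p, OF A y] by blast
  have "induced_norm A p (x + y) \<le> (\<Sum>a\<in>A. \<bar>c a + d a\<bar> * p a)"
    using induced_norm_le[of A p "\<lambda>a. c a + d a", OF A] c(1) d(1)
    by (simp add: scaleR_left_distrib sum.distrib)
  also have "\<dots> \<le> (\<Sum>a\<in>A. \<bar>c a\<bar> * p a + \<bar>d a\<bar> * p a)"
    unfolding distrib_right[symmetric] using A(2) by (intro sum_mono mult_right_mono) auto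
  finally show ?thesis using c(2) d(2) by (simp add: sum.distrib)
qed

lemma induced_norm_scale:
  assumes A: "finite A" "\<And>a. a \<in> A \<Longrightarrow> 0 \<le> p a" and x: "x \<in> span A"
  shows "induced_norm A p (k *\<^sub>R x) = \<bar>k\<bar> * induced_norm A p x"
proof -
  have le: "induced_norm A p (k *\<^sub>R x) \<le> \<bar>k\<bar> * induced_norm A p x" if x: "x \<in> span A" for k x
  proof -
    obtain c where c: "(\<Sum>a\<in>A. c a *\<^sub>R a) = x" "induced_norm A p x = (\<Sum>a\<in>A. \<bar>c a\<bar> * p a)"
      using induced_norm_attained_combination[of A p, OF A x] by blast
    have "induced_norm A p (\<Sum>a\<in>A. (k * c a) *\<^sub>R a) \<le> (\<Sum>a\<in>A. \<bar>k * c a\<bar> * p a)"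
      by (rule induced_norm_le[OF A])
    moreover have "(\<Sum>a\<in>A. (k * c a) *\<^sub>R a) = k *\<^sub>R x"
      by (simp add: c(1)[symmetric] scaleR_sum_right)
    ultimately show ?thesis by (simp add: c(2) abs_mult sum_distrib_left mult.assoc)
  qed
  show ?thesis
  proof (cases "k = 0")
    case True
    then show ?thesis using le[OF x, of 0] induced_norm_nonneg[of A p, OF A span_zero] by simp
  next
    case False
    have "induced_norm A p x \<le> \<bar>inverse k\<bar> * induced_norm A p (k *\<^sub>R x)"
      using le[of "k *\<^sub>R x" "inverse k"] x False by (simp add: span_scale)
    then have "\<bar>k\<bar> * induced_norm A p x \<le> induced_norm A p (k *\<^sub>R x)"
      using False by (simp add: field_simps abs_mult[symmetric])
    with le[OF x] show ?thesis by (intro antisym)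
  qed
qed

lemma induced_norm_sum_le:
  assumes A: "finite A" "\<And>a. a \<in> A \<Longrightarrow> 0 \<le> p a" and v: "\<And>i. i \<in> I \<Longrightarrow> v i \<in> span A"
  shows "induced_norm A p (\<Sum>i\<in>I. c i *\<^sub>R v i) \<le> (\<Sum>i\<in>I. \<bar>c i\<bar> * induced_norm A p (v i))"
proof -
  have N0: "induced_norm A p 0 = 0"
    using induced_norm_scale[of A p 0 0, OF A span_zero] by simp
  show ?thesis
    using v
  proof (induction I rule: infinite_finite_induct)
    case (insert i I)
    have vi: "v i \<in> span A" and s: "(\<Sum>i\<in>I. c i *\<^sub>R v i) \<in> span A"
      using insert.prems by (auto intro!: span_sum span_scale)
    have "induced_norm A p (c i *\<^sub>R v i + (\<Sum>i\<in>I. c i *\<^sub>R v i)) \<le>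
        \<bar>c i\<bar> * induced_norm A p (v i) + induced_norm A p (\<Sum>i\<in>I. c i *\<^sub>R v i)"
      using induced_norm_triangle[of A p, OF A span_scale[OF vi] s]
        induced_norm_scale[of A p, OF A vi] by simp
    then show ?case using insert.IH insert.prems insert.hyps by simp
  qed (simp_all add: N0)
qed

lemma induced_norm_generator_le:
  assumes A: "finite A" "\<And>a. a \<in> A \<Longrightarrow> 0 \<le> p a" and "a \<in> A"
  shows "induced_norm A p a \<le> p a"
proof -
  let ?c = "\<lambda>x. if x = a then 1 else (0::real)"
  have "(\<Sum>x\<in>A. ?c x *\<^sub>R x) = a" "(\<Sum>x\<in>A. \<bar>?c x\<bar> * p x) = p a"
    using A(1) assms(3)
    by (simp_all add: if_distrib[of "\<lambda>c. c *\<^sub>R _"] if_distrib[of "\<lambda>c. c * _"]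
        if_distrib[of abs] cong: if_cong)
  then show ?thesis using induced_norm_le[of A p ?c, OF A] by simp
qed

text \<open>The infimum being attained, it is the cost of an actual combination, and a combination
  with a nonzero value uses some nonzero vector with a nonzero coefficient.\<close>

lemma induced_norm_definite:
  assumes A: "finite A" "\<And>a. a \<in> A \<Longrightarrow> 0 \<le> p a" "\<And>a. a \<in> A \<Longrightarrow> a \<noteq> 0 \<Longrightarrow> 0 < p a"
    and x: "x \<in> span A" "x \<noteq> 0"
  shows "0 < induced_norm A p x"
proof -
  obtain c where c: "(\<Sum>a\<in>A. c a *\<^sub>R a) = x" "induced_norm A p x = (\<Sum>a\<in>A. \<bar>c a\<bar> * p a)"
    using induced_norm_attained_combination[of A p, OF A(1,2) x(1)] by blast
  have "\<exists>a\<in>A. c a *\<^sub>R a \<noteq> 0"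
  proof (rule ccontr)
    assume "\<not> ?thesis"
    then have "(\<Sum>a\<in>A. c a *\<^sub>R a) = 0" by (intro sum.neutral) auto
    with c(1) x(2) show False by simp
  qed
  then obtain a where a: "a \<in> A" "c a \<noteq> 0" "a \<noteq> 0" by auto
  have "0 < (\<Sum>a\<in>A. \<bar>c a\<bar> * p a)"
    using a A by (intro sum_pos2[of A a]) auto
  then show ?thesis using c(2) by simp
qed

lemma is_norm_on_induced_norm:
  assumes A: "finite A" "\<And>a. a \<in> A \<Longrightarrow> 0 \<le> p a" "\<And>a. a \<in> A \<Longrightarrow> a \<noteq> 0 \<Longrightarrow> 0 < p a"
  shows "is_norm_on (span A) (induced_norm A p)"
  unfolding is_norm_on_def
  using induced_norm_nonneg[of A p, OF A(1,2)] induced_norm_definite[of A p, OF A]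
    induced_norm_scale[of A p, OF A(1,2)] induced_norm_triangle[of A p, OF A(1,2)]
    induced_norm_scale[of A p 0 0, OF A(1,2) span_zero]
  by force

text \<open>The weights need not form a partial norm: replacing them by the values of the induced
  norm itself does not change the induced norm, and those values are rational on rational
  vectors. This makes it easy to exhibit members of the class.\<close>

lemma class_K_induced_norm:
  assumes B: "finite B" "independent B" and A: "finite A" "B \<subseteq> A" "A \<subseteq> rational_span B"
    and p: "\<And>a. a \<in> A \<Longrightarrow> 0 \<le> p a" "\<And>a. a \<in> A \<Longrightarrow> a \<noteq> 0 \<Longrightarrow> 0 < p a"
      "\<And>a. a \<in> A \<Longrightarrow> p a \<in> \<rat>"
  shows "\<lparr>bs_space = span B, bs_norm = induced_norm A p, bs_basis = B\<rparr> \<in> class_K"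
proof -
  let ?N = "induced_norm A p"
  have span: "span A = span B"
  proof (rule antisym)
    have "A \<subseteq> span B" using A(3) rational_span_subset_span by blast
    then show "span A \<subseteq> span B" by (rule span_minimal) simp
    show "span B \<subseteq> span A" by (rule span_mono[OF A(2)])
  qed
  have norm: "is_norm_on (span A) ?N" by (rule is_norm_on_induced_norm[OF A(1) p(1,2)])
  have sA: "a \<in> span A" if "a \<in> A" for a using that by (rule span_base)
  have part: "partial_norm A ?N"
    unfolding partial_norm_def using norm sA by (auto simp: is_norm_on_def)
  have N0: "0 \<le> ?N a" if "a \<in> A" for a
    using part that by (auto simp: partial_norm_def)
  have same: "induced_norm A ?N x = ?N x" if x: "x \<in> span A" for x
  proof (rule antisym)
    obtain c where c: "(\<Sum>a\<in>A. c a *\<^sub>R a) = x" "?N x = (\<Sum>a\<in>A. \<bar>c a\<bar> * p a)"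
      using induced_norm_attained_combination[of A p, OF A(1) p(1) x] by blast
    have "induced_norm A ?N x \<le> (\<Sum>a\<in>A. \<bar>c a\<bar> * ?N a)"
      using induced_norm_le[of A ?N c, OF A(1) N0] c(1) by simp
    also have "\<dots> \<le> ?N x"
      unfolding c(2) using induced_norm_generator_le[of A p, OF A(1) p(1)]
      by (intro sum_mono mult_left_mono) auto
    finally show "induced_norm A ?N x \<le> ?N x" .
    obtain d where d: "(\<Sum>a\<in>A. d a *\<^sub>R a) = x" "induced_norm A ?N x = (\<Sum>a\<in>A. \<bar>d a\<bar> * ?N a)"
      using induced_norm_attained_combination[of A ?N, OF A(1) N0 x] by blast
    have "?N (\<Sum>a\<in>A. d a *\<^sub>R a) \<le> (\<Sum>a\<in>A. \<bar>d a\<bar> * ?N a)"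
      using sA by (intro induced_norm_sum_le[of A p, OF A(1) p(1)]) auto
    then show "?N x \<le> induced_norm A ?N x" using d by simp
  qed
  have rat: "?N a \<in> \<rat>" if "a \<in> A" for a
    using induced_norm_rational[of B A p a, OF B A(1,3) p(1,3) sA[OF that]] that A(3) by blast
  have comb: "\<exists>q. (\<forall>b\<in>B. q b \<in> \<rat>) \<and> a = (\<Sum>b\<in>B. q b *\<^sub>R b)" if "a \<in> A" for a
    using that A(3) unfolding rational_span_def by blast
  have "A \<subseteq> span B" using span sA by blast
  then have "finite A \<and> A \<subseteq> span B \<and> B \<subseteq> A \<and>
      (\<forall>a\<in>A. \<exists>q. (\<forall>b\<in>B. q b \<in> \<rat>) \<and> a = (\<Sum>b\<in>B. q b *\<^sub>R b)) \<and>
      partial_norm A ?N \<and> (\<forall>a\<in>A. ?N a \<in> \<rat>) \<and> (\<forall>x\<in>span B. ?N x = induced_norm A ?N x)"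
    using A(1,2) part rat comb same[unfolded span] by (intro conjI ballI) simp_all
  then have "\<exists>A p. finite A \<and> A \<subseteq> span B \<and> B \<subseteq> A \<and>
      (\<forall>a\<in>A. \<exists>q. (\<forall>b\<in>B. q b \<in> \<rat>) \<and> a = (\<Sum>b\<in>B. q b *\<^sub>R b)) \<and>
      partial_norm A p \<and> (\<forall>a\<in>A. p a \<in> \<rat>) \<and> (\<forall>x\<in>span B. ?N x = induced_norm A p x)"
    by (intro exI)
  with B norm[unfolded span] show ?thesis unfolding class_K_def by simp
qed

lemma class_K_basis:
  assumes "V \<in> class_K"
  shows "finite (bs_basis V)" "independent (bs_basis V)" "span (bs_basis V) = bs_space V"
    "is_norm_on (bs_space V) (bs_norm V)"
  using assms by (auto simp: class_K_def)

lemma class_K_induced_normE: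
  assumes "V \<in> class_K"
  obtains A p where "finite A" "bs_basis V \<subseteq> A" "A \<subseteq> rational_span (bs_basis V)"
    "\<And>a. a \<in> A \<Longrightarrow> 0 \<le> p a" "\<And>a. a \<in> A \<Longrightarrow> p a \<in> \<rat>" "span A = bs_space V"
    "\<And>x. x \<in> bs_space V \<Longrightarrow> bs_norm V x = induced_norm A p x"
proof -
  obtain A p where A: "finite A" "A \<subseteq> bs_space V" "bs_basis V \<subseteq> A"
    "A \<subseteq> rational_span (bs_basis V)" "partial_norm A p" "\<And>a. a \<in> A \<Longrightarrow> p a \<in> \<rat>"
    "\<And>x. x \<in> bs_space V \<Longrightarrow> bs_norm V x = induced_norm A p x"
    using assms unfolding class_K_def rational_span_def by blast
  have "span A = bs_space V"
  proof (rule antisym)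
    show "span A \<subseteq> bs_space V"
      using A(2) unfolding class_K_basis(3)[OF assms, symmetric] by (rule span_minimal) simp
    show "bs_space V \<subseteq> span A"
      unfolding class_K_basis(3)[OF assms, symmetric] by (rule span_mono[OF A(3)])
  qed
  with A show thesis by (intro that[of A p]) (auto simp: partial_norm_def)
qed

lemma class_K_norm_rational:
  assumes "V \<in> class_K" "x \<in> rational_span (bs_basis V)"
  shows "bs_norm V x \<in> \<rat>"
proof -
  obtain A p where A: "finite A" "bs_basis V \<subseteq> A" "A \<subseteq> rational_span (bs_basis V)"
    "\<And>a. a \<in> A \<Longrightarrow> 0 \<le> p a" "\<And>a. a \<in> A \<Longrightarrow> p a \<in> \<rat>" "span A = bs_space V"
    "\<And>x. x \<in> bs_space V \<Longrightarrow> bs_norm V x = induced_norm A p x"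
    using class_K_induced_normE[OF assms(1)] by blast
  note B = class_K_basis[OF assms(1)]
  have "x \<in> span A" using assms(2) rational_span_subset_span B(3) A(6) by blast
  then show ?thesis
    using induced_norm_rational[of "bs_basis V" A p x, OF B(1,2) A(1,3,4,5) _ assms(2)] A(6,7) by simp
qed

text \<open>The norm of a member of the class is generated by its own values on a finite set of
  rational vectors, so the partial norm that presents the space can be forgotten.\<close>

lemma class_K_self_generated:
  assumes "V \<in> class_K"
  obtains A where "finite A" "bs_basis V \<subseteq> A" "A \<subseteq> rational_span (bs_basis V)"
    "\<And>x. x \<in> bs_space V \<Longrightarrow>
      \<exists>c. (\<Sum>a\<in>A. c a *\<^sub>R a) = x \<and> (\<Sum>a\<in>A. \<bar>c a\<bar> * bs_norm V a) \<le> bs_norm V x"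
proof -
  obtain A p where A: "finite A" "bs_basis V \<subseteq> A" "A \<subseteq> rational_span (bs_basis V)"
    "\<And>a. a \<in> A \<Longrightarrow> 0 \<le> p a" "\<And>a. a \<in> A \<Longrightarrow> p a \<in> \<rat>" "span A = bs_space V"
    "\<And>x. x \<in> bs_space V \<Longrightarrow> bs_norm V x = induced_norm A p x"
    using class_K_induced_normE[OF assms(1)] by blast
  have "\<exists>c. (\<Sum>a\<in>A. c a *\<^sub>R a) = x \<and> (\<Sum>a\<in>A. \<bar>c a\<bar> * bs_norm V a) \<le> bs_norm V x"
    if x: "x \<in> bs_space V" for x
  proof -
    obtain c where c: "(\<Sum>a\<in>A. c a *\<^sub>R a) = x" "induced_norm A p x = (\<Sum>a\<in>A. \<bar>c a\<bar> * p a)"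
      using induced_norm_attained_combination[of A p x, OF A(1,4)] x A(6) by blast
    have "bs_norm V a \<le> p a" if "a \<in> A" for a
      using induced_norm_generator_le[of A p a, OF A(1,4) that] A(7)[of a] A(6) span_base[OF that]
      by simp
    then have "(\<Sum>a\<in>A. \<bar>c a\<bar> * bs_norm V a) \<le> bs_norm V x"
      unfolding A(7)[OF x] c(2) by (intro sum_mono mult_left_mono) auto
    with c(1) show ?thesis by blast
  qed
  with A show thesis by (intro that)
qed

section \<open>Finite dimensional normed spaces\<close>

text \<open>All norms on a finite dimensional space are equivalent. In coordinates the unit
  sphere of the \<open>\<ell>\<^sub>1\<close>-norm is closed in a product of compact intervals, hence compact, and
  the given norm has a positive minimum on it.\<close>

lemma coordinates_bounded:
  fixes B :: "'a::real_normed_vector set"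
  assumes B: "finite B" "independent B"
  obtains C where "0 < C"
    "\<And>x. x \<in> span B \<Longrightarrow> (\<Sum>b\<in>B. \<bar>representation B x b\<bar>) \<le> C * norm x"
proof -
  define L where "L c = (\<Sum>b\<in>B. \<bar>c b\<bar>)" for c :: "'a \<Rightarrow> real"
  define box where "box = (\<lambda>b. if b \<in> B then {-1..1::real} else {0})"
  define K where "K = PiE UNIV box \<inter> {c. L c = 1}"
  have "compact (PiE UNIV box)"
  proof -
    have "compactin (product_topology (\<lambda>_. euclidean) UNIV) (PiE UNIV box)"
      unfolding compactin_PiE by (auto simp: box_def)
    then show ?thesis by (simp add: euclidean_product_topology)
  qed
  moreover have "continuous_on UNIV L"
    unfolding L_def by (intro continuous_intros) auto
  then have "closed {c. L c = 1}"
    by (intro closed_Collect_eq continuous_intros)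
  ultimately have cK: "compact K" unfolding K_def by (intro compact_Int_closed)
  have cont: "continuous_on K (\<lambda>c. norm (\<Sum>b\<in>B. c b *\<^sub>R b))"
    by (intro continuous_intros continuous_on_subset[OF continuous_on_product_coordinates]) auto
  have scaled: "(\<lambda>b. c b / L c) \<in> K" if "\<And>b. b \<notin> B \<Longrightarrow> c b = 0" "L c \<noteq> 0" for c
  proof -
    have pos: "0 < L c" using that(2) sum_nonneg[of B "\<lambda>b. \<bar>c b\<bar>"] by (simp add: L_def less_le)
    have "- L c \<le> c b \<and> c b \<le> L c" if "b \<in> B" for b
      using member_le_sum[of b B "\<lambda>b. \<bar>c b\<bar>"] B(1) that by (auto simp: L_def)
    then have "(\<lambda>b. c b / L c) \<in> PiE UNIV box"
      using pos that(1) by (auto simp: box_def field_simps)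
    moreover have "L (\<lambda>b. c b / L c) = 1"
      using pos unfolding L_def[of "\<lambda>b. c b / L c"]
      by (simp add: sum_divide_distrib[symmetric] L_def[symmetric])
    ultimately show ?thesis by (simp add: K_def)
  qed
  show thesis
  proof (cases "K = {}")
    case True
    have "(\<Sum>b\<in>B. \<bar>representation B x b\<bar>) = 0" for x
      using scaled[of "representation B x"] representation_ne_zero[of B x] True
      unfolding L_def by blast
    then show thesis by (intro that[of 1]) simp_all
  next
    case False
    obtain c0 where c0: "c0 \<in> K"
      and min: "\<And>c. c \<in> K \<Longrightarrow> norm (\<Sum>b\<in>B. c0 b *\<^sub>R b) \<le> norm (\<Sum>b\<in>B. c b *\<^sub>R b)"
      using continuous_attains_inf[OF cK False cont] by blast
    define m where "m = norm (\<Sum>b\<in>B. c0 b *\<^sub>R b)"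
    have "m \<noteq> 0"
    proof
      assume "m = 0"
      then have "c0 b = 0" if "b \<in> B" for b
        using independentD[OF B(2,1) order_refl _ that, of c0] by (simp add: m_def)
      then have "L c0 = 0" by (simp add: L_def)
      with c0 show False by (simp add: K_def)
    qed
    then have m: "0 < m" by (simp add: m_def)
    show thesis
    proof (rule that[of "1 / m"])
      fix x assume x: "x \<in> span B"
      let ?r = "representation B x"
      have xr: "(\<Sum>b\<in>B. ?r b *\<^sub>R b) = x"
        using sum_representation_eq[OF B(2) x B(1)] by simp
      have pos: "0 \<le> L ?r" by (simp add: L_def sum_nonneg)
      show "(\<Sum>b\<in>B. \<bar>?r b\<bar>) \<le> 1 / m * norm x"
      proof (cases "L ?r = 0")
        case True
        then show ?thesis using m by (simp add: L_def)
      next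
        case False
        have "m \<le> norm (\<Sum>b\<in>B. (?r b / L ?r) *\<^sub>R b)"
          unfolding m_def using False representation_ne_zero by (intro min scaled) blast+
        also have "(\<Sum>b\<in>B. (?r b / L ?r) *\<^sub>R b) = (1 / L ?r) *\<^sub>R x"
          by (subst xr[symmetric]) (simp add: scaleR_sum_right)
        finally have "m \<le> norm x / L ?r" using pos by simp
        then show ?thesis using m pos False by (simp add: L_def[symmetric] field_simps)
      qed
    qed (use m in simp)
  qed
qed

text \<open>Used for perturbation arguments: two linear maps that are sufficiently close on a basis
  are close relative to the norm on the whole span.\<close>

lemma linear_small_of_small_on_basis:
  fixes B :: "'a::real_normed_vector set"
  assumes B: "finite B" "independent B" and "0 < \<delta>"
  shows "\<exists>\<eta>>0. \<forall>h :: 'a \<Rightarrow> 'b::real_normed_vector. linear h \<longrightarrow> (\<forall>b\<in>B. norm (h b) \<le> \<eta>) \<longrightarrow>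
    (\<forall>x\<in>span B. norm (h x) \<le> \<delta> * norm x)"
proof -
  obtain C where C: "0 < C"
    "\<And>x. x \<in> span B \<Longrightarrow> (\<Sum>b\<in>B. \<bar>representation B x b\<bar>) \<le> C * norm x"
    using coordinates_bounded[OF B] by blast
  show ?thesis
  proof (intro exI[of _ "\<delta> / C"] conjI allI impI ballI)
    fix h :: "'a \<Rightarrow> 'b" and x
    assume h: "linear h" "\<forall>b\<in>B. norm (h b) \<le> \<delta> / C" and x: "x \<in> span B"
    let ?r = "representation B x"
    have "(\<Sum>b\<in>B. ?r b *\<^sub>R b) = x"
      using sum_representation_eq[OF B(2) x B(1)] by simp
    then have "h x = h (\<Sum>b\<in>B. ?r b *\<^sub>R b)" by simp
    also have "\<dots> = (\<Sum>b\<in>B. ?r b *\<^sub>R h b)" using h(1) by (simp add: linear_sum linear_scale)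
    finally have "norm (h x) \<le> (\<Sum>b\<in>B. norm (?r b *\<^sub>R h b))" by (simp only: norm_sum)
    also have "\<dots> \<le> (\<Sum>b\<in>B. \<bar>?r b\<bar> * (\<delta> / C))"
      unfolding norm_scaleR using h(2) by (intro sum_mono mult_left_mono) auto
    also have "\<dots> = (\<delta> / C) * (\<Sum>b\<in>B. \<bar>?r b\<bar>)" by (simp add: sum_distrib_left sum_divide_distrib mult.commute)
    also have "\<dots> \<le> (\<delta> / C) * (C * norm x)"
      using C assms(3) x by (intro mult_left_mono) auto
    finally show "norm (h x) \<le> \<delta> * norm x" using C(1) by simp
  qed (use C assms in simp)
qed

text \<open>Round the coordinates of a unit vector \<open>z\<close> down to multiples of \<open>1/m\<close>. The rounded vector is
  one of finitely many rational vectors and has norm close to 1; the remainder is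
  a combination of basis vectors with coefficients at most \<open>1/m\<close>, hence cheap.\<close>

lemma finite_rational_generators:
  fixes B :: "'a::real_normed_vector set"
  assumes B: "finite B" "independent B" and \<delta>: "0 < \<delta>"
  obtains Y where "finite Y" "B \<subseteq> Y" "Y \<subseteq> rational_span B"
    "\<And>z. z \<in> span B \<Longrightarrow> \<exists>c. (\<Sum>y\<in>Y. c y *\<^sub>R y) = z \<and> (\<Sum>y\<in>Y. \<bar>c y\<bar> * norm y) \<le> (1 + \<delta>) * norm z"
proof -
  obtain C where C: "0 < C"
    "\<And>x. x \<in> span B \<Longrightarrow> (\<Sum>b\<in>B. \<bar>representation B x b\<bar>) \<le> C * norm x"
    using coordinates_bounded[OF B] by blast
  define s where "s = (\<Sum>b\<in>B. norm b)"
  have s0: "0 \<le> s" by (simp add: s_def sum_nonneg)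
  obtain m0 :: nat where m0: "2 * s / \<delta> < real m0" using reals_Archimedean2 by blast
  define m where "m = Suc m0"
  have m: "0 < real m" "2 * s / real m \<le> \<delta>"
    using m0 \<delta> s0 by (auto simp: m_def field_simps)
  define K where "K = \<lceil>m * C\<rceil> + 1"
  define grid where "grid k = (\<Sum>b\<in>B. (of_int (k b) / real m) *\<^sub>R b)" for k :: "'a \<Rightarrow> int"
  define Y where "Y = grid ` (PiE B (\<lambda>_. {-K..K})) \<union> B"
  have Yfin: "finite Y" using B(1) by (auto simp: Y_def intro!: finite_PiE)
  have unit: "\<exists>c. (\<Sum>y\<in>Y. c y *\<^sub>R y) = z \<and> (\<Sum>y\<in>Y. \<bar>c y\<bar> * norm y) \<le> 1 + \<delta>"
    if z: "z \<in> span B" "norm z = 1" for z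
  proof -
    let ?r = "representation B z"
    have zr: "(\<Sum>b\<in>B. ?r b *\<^sub>R b) = z"
      using sum_representation_eq[OF B(2) z(1) B(1)] by simp
    have rC: "\<bar>?r b\<bar> \<le> C" if "b \<in> B" for b
    proof -
      have "\<bar>?r b\<bar> \<le> (\<Sum>b\<in>B. \<bar>?r b\<bar>)" using B(1) that by (intro member_le_sum) auto
      then show ?thesis using C(2)[OF z(1)] z(2) by simp
    qed
    define k where "k = restrict (\<lambda>b. \<lfloor>m * ?r b\<rfloor>) B"
    define \<rho> where "\<rho> b = (if b \<in> B then ?r b - of_int (k b) / real m else 0)" for b
    have \<rho>: "0 \<le> \<rho> b" "\<rho> b \<le> 1 / m" for b
    proof -
      have "of_int (k b) \<le> m * ?r b" "m * ?r b \<le> of_int (k b) + 1" if "b \<in> B"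
        using that by (auto simp: k_def)
      then have "of_int (k b) / m \<le> ?r b" "?r b \<le> (of_int (k b) + 1) / m" if "b \<in> B"
        using m(1) that by (simp_all add: pos_divide_le_eq pos_le_divide_eq mult.commute)
      then show "0 \<le> \<rho> b" "\<rho> b \<le> 1 / m" by (auto simp: \<rho>_def add_divide_distrib)
    qed
    have kK: "k \<in> PiE B (\<lambda>_. {-K..K})"
    proof (rule PiE_I)
      fix b assume b: "b \<in> B"
      have "\<bar>m * ?r b\<bar> \<le> m * C" using rC[OF b] m(1) by (simp add: abs_mult)
      then have "-K \<le> \<lfloor>m * ?r b\<rfloor>" "\<lfloor>m * ?r b\<rfloor> \<le> K" unfolding K_def by linarith+
      then show "k b \<in> {-K..K}" using b by (simp add: k_def)
    qed (simp add: k_def)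
    define y where "y = grid k"
    have y: "y \<in> Y" using kK by (auto simp: Y_def y_def)
    have zy: "z = y + (\<Sum>b\<in>B. \<rho> b *\<^sub>R b)"
      unfolding y_def grid_def sum.distrib[symmetric]
      by (subst zr[symmetric]) (auto simp: \<rho>_def scaleR_left_distrib[symmetric] intro!: sum.cong)
    have rem: "(\<Sum>b\<in>B. \<rho> b * norm b) \<le> s / m"
      unfolding s_def sum_divide_distrib
      using \<rho> mult_right_mono[OF \<rho>(2), of "norm _"] by (intro sum_mono) simp
    have "norm (\<Sum>b\<in>B. \<rho> b *\<^sub>R b) \<le> (\<Sum>b\<in>B. \<rho> b * norm b)"
      using \<rho> norm_sum[of "\<lambda>b. \<rho> b *\<^sub>R b" B] by simp
    then have ynorm: "norm y \<le> 1 + s / m"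
      using rem zy z(2) norm_triangle_ineq4[of z "\<Sum>b\<in>B. \<rho> b *\<^sub>R b"] by simp
    define c where "c v = (if v = y then 1 else 0) + \<rho> v" for v
    have \<rho>0: "\<rho> v = 0" if "v \<notin> B" for v using that by (simp add: \<rho>_def)
    have sumB: "(\<Sum>v\<in>Y. g v) = (\<Sum>v\<in>B. g v)" if "\<And>v. v \<notin> B \<Longrightarrow> g v = 0"
      for g :: "'a \<Rightarrow> 'd::comm_monoid_add"
      using that Yfin by (intro sum.mono_neutral_right) (auto simp: Y_def)
    have "(\<Sum>v\<in>Y. c v *\<^sub>R v) = (\<Sum>v\<in>Y. if v = y then v else 0) + (\<Sum>v\<in>Y. \<rho> v *\<^sub>R v)"
      unfolding sum.distrib[symmetric] by (intro sum.cong) (auto simp: c_def scaleR_left_distrib)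
    also have "\<dots> = y + (\<Sum>b\<in>B. \<rho> b *\<^sub>R b)"
      using Yfin y sumB[of "\<lambda>v. \<rho> v *\<^sub>R v"] \<rho>0 by simp
    also note zy[symmetric]
    finally have 1: "(\<Sum>v\<in>Y. c v *\<^sub>R v) = z" .
    have "(\<Sum>v\<in>Y. \<bar>c v\<bar> * norm v) = (\<Sum>v\<in>Y. if v = y then norm v else 0) + (\<Sum>v\<in>Y. \<rho> v * norm v)"
      unfolding sum.distrib[symmetric] using \<rho> by (intro sum.cong) (auto simp: c_def distrib_right)
    also have "\<dots> = norm y + (\<Sum>b\<in>B. \<rho> b * norm b)"
      using Yfin y sumB[of "\<lambda>v. \<rho> v * norm v"] \<rho>0 by simp
    also have "\<dots> \<le> 1 + \<delta>" using ynorm rem m(2) by simp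
    finally show ?thesis using 1 by blast
  qed
  show thesis
  proof (rule that[of Y])
    have "grid k \<in> rational_span B" for k
      unfolding grid_def by (rule rational_spanI[OF _ refl]) simp
    then show "Y \<subseteq> rational_span B"
      using rational_span_base[OF B(1)] by (auto simp: Y_def)
    fix z assume z: "z \<in> span B"
    show "\<exists>c. (\<Sum>y\<in>Y. c y *\<^sub>R y) = z \<and> (\<Sum>y\<in>Y. \<bar>c y\<bar> * norm y) \<le> (1 + \<delta>) * norm z"
    proof (cases "z = 0")
      case True
      then show ?thesis by (intro exI[of _ "\<lambda>_. 0"]) simp
    next
      case False
      obtain c where c: "(\<Sum>y\<in>Y. c y *\<^sub>R y) = (1 / norm z) *\<^sub>R z"
        "(\<Sum>y\<in>Y. \<bar>c y\<bar> * norm y) \<le> 1 + \<delta>"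
        using unit[of "(1 / norm z) *\<^sub>R z"] z False by (auto simp: span_scale)
      have "(\<Sum>y\<in>Y. (norm z * c y) *\<^sub>R y) = norm z *\<^sub>R (\<Sum>y\<in>Y. c y *\<^sub>R y)"
        by (simp add: scaleR_sum_right)
      then have "(\<Sum>y\<in>Y. (norm z * c y) *\<^sub>R y) = z" using c(1) False by simp
      moreover have "(\<Sum>y\<in>Y. \<bar>norm z * c y\<bar> * norm y) = norm z * (\<Sum>y\<in>Y. \<bar>c y\<bar> * norm y)"
        by (simp add: abs_mult sum_distrib_left mult.assoc)
      then have "(\<Sum>y\<in>Y. \<bar>norm z * c y\<bar> * norm y) \<le> (1 + \<delta>) * norm z"
        using c(2) mult_left_mono[OF c(2), of "norm z"] by (simp add: mult.commute)
      ultimately show ?thesis by (intro exI[of _ "\<lambda>y. norm z * c y"]) simp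
    qed
  qed (use Yfin in \<open>auto simp: Y_def\<close>)
qed

lemma linear_extension_from_span:
  assumes "independent B" "linear_map_on (span B) f"
  obtains g where "linear g" "\<And>x. x \<in> span B \<Longrightarrow> g x = f x"
proof -
  obtain g where g: "linear g" "\<forall>b\<in>B. g b = f b"
    using linear_independent_extend[OF assms(1), of f] by blast
  have "x \<in> span B \<and> g x = f x" if "x \<in> span B" for x
    using that
  proof (induction rule: span_induct_alt)
    case base
    have "f 0 = 0" using assms(2) span_zero[of B] unfolding linear_map_on_def
      by (metis scaleR_zero_left)
    then show ?case using g(1) by (simp add: linear_0 span_zero)
  next
    case (step c b y)
    then have b: "b \<in> span B" "c *\<^sub>R b \<in> span B" by (auto intro: span_base span_scale)
    then show ?case using step g assms(2) unfolding linear_map_on_def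
      by (simp add: linear_add linear_scale span_add)
  qed
  with g(1) show thesis using that by blast
qed

lemma linear_map_on_linear: "linear g \<Longrightarrow> linear_map_on V g"
  by (simp add: linear_map_on_def linear_add linear_scale)

section \<open>Amalgamation with an almost isometric subspace\<close>

lemma keys_span_subset:
  assumes "x \<in> span S" shows "Poly_Mapping.keys (x :: c00) \<subseteq> (\<Union>s\<in>S. Poly_Mapping.keys s)"
  using assms
proof (induction rule: span_induct_alt)
  case (step c b y)
  have "Poly_Mapping.keys (c *\<^sub>R b) \<subseteq> Poly_Mapping.keys b"
    by (auto simp: scaleR_poly_mapping_def in_keys_iff)
  then show ?case using step Poly_Mapping.keys_add[of "c *\<^sub>R b" y] by blast
qed simp

text \<open>A vector supported at a coordinate that no element of \<open>S\<close> uses lies outside of the span.\<close>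

lemma finite_span_c00_proper:
  assumes "finite S" shows "\<exists>x::c00. x \<notin> span S"
proof -
  have "finite (\<Union>s\<in>S. Poly_Mapping.keys s)" using assms by simp
  then obtain i where "i \<notin> (\<Union>s\<in>S. Poly_Mapping.keys s)"
    using ex_new_if_finite infinite_UNIV_nat by blast
  then have "Poly_Mapping.single i (1::real) \<notin> span S"
    using keys_span_subset[of "Poly_Mapping.single i 1" S] by auto
  then show ?thesis by blast
qed

lemma fresh_independent_vectors:
  assumes "finite B" "independent (B :: c00 set)" "finite U"
  shows "\<exists>u :: 'u \<Rightarrow> c00. inj_on u U \<and> u ` U \<inter> B = {} \<and> independent (B \<union> u ` U)"
  using assms(3)
proof (induction U rule: finite_induct)
  case empty
  show ?case using assms(2) by simp
next
  case (insert z U)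
  then obtain u :: "'u \<Rightarrow> c00"
    where u: "inj_on u U" "u ` U \<inter> B = {}" "independent (B \<union> u ` U)" by blast
  obtain x :: c00 where x: "x \<notin> span (B \<union> u ` U)"
    using finite_span_c00_proper[of "B \<union> u ` U"] assms(1) insert.hyps by auto
  have x': "x \<notin> B" "x \<notin> u ` U" using x by (auto intro: span_base)
  have im: "(u(z := x)) ` insert z U = insert x (u ` U)"
    using insert.hyps by (auto simp: fun_upd_def)
  have "independent (insert x (B \<union> u ` U))" using x u(3) by (rule independent_insertI)
  then show ?case
    using u x' insert.hyps im by (intro exI[of _ "u(z := x)"]) (auto simp: inj_on_def)
qed

text \<open>This is the amalgamation step that carries the proof. Given a member \<open>V\<close> of the class, a
  finite dimensional normed space \<open>F = span BF\<close> and an almost isometric map \<open>T\<close> from the subspace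
  \<open>E = span BE\<close> into \<open>V\<close>, one glues \<open>V\<close> and \<open>F\<close> along \<open>T\<close> inside the class, keeping \<open>V\<close> and its
  basis exactly and \<open>F\<close> almost isometrically.

  The vector space \<open>W\<close> is spanned by the basis of \<open>V\<close> and one fresh vector for each element of
  \<open>BF - BE\<close>. Its norm is induced by a finite set consisting of rational generators of \<open>V\<close>, weighted
  by the norm of \<open>V\<close>, and the images \<open>S y\<close> of rational generators \<open>y\<close> of \<open>F\<close>, with weights
  between \<open>(1 + \<delta>) * norm y\<close> and \<open>(1 + 2 * \<delta>) * norm y\<close>. The factor \<open>1 + \<delta>\<close> pays for the expansion of \<open>T\<close>: a detour through \<open>F\<close>
  that starts and ends in \<open>V\<close> is never shorter than the direct way, so the norm of \<open>V\<close> does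
  not shrink. Because \<open>T\<close> contracts by at most \<open>1 - \<delta>\<close>, detours through \<open>V\<close> shorten the norm of \<open>F\<close>
  by no more than that factor.\<close>

lemma approximate_amalgamation:
  fixes V :: "c00 based_space" and T :: "'f::real_normed_vector \<Rightarrow> c00"
  assumes V: "V \<in> class_K"
    and BF: "finite BF" "independent BF" and BE: "BE \<subseteq> BF"
    and T: "linear T" "\<And>b. b \<in> BE \<Longrightarrow> T b \<in> rational_span (bs_basis V)"
    and \<delta>: "0 < \<delta>" "\<delta> < 1"
    and Tle: "\<And>x. x \<in> span BE \<Longrightarrow> bs_norm V (T x) \<le> (1 + \<delta>) * norm x"
    and Tge: "\<And>x. x \<in> span BE \<Longrightarrow> (1 - \<delta>) * norm x \<le> bs_norm V (T x)"
  obtains W S where "W \<in> class_K" "(\<lambda>x. x) \<in> class_E V W" "linear S" "\<And>b. b \<in> BE \<Longrightarrow> S b = T b"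
    "\<And>z. z \<in> span BF \<Longrightarrow> S z \<in> bs_space W"
    "\<And>z. z \<in> span BF \<Longrightarrow> (1 - \<delta>) * norm z \<le> bs_norm W (S z)"
    "\<And>z. z \<in> span BF \<Longrightarrow> bs_norm W (S z) \<le> (1 + 2 * \<delta>) * (1 + \<delta>) * norm z"
proof -
  define B where "B = bs_basis V"
  define NV where "NV = bs_norm V"
  have B: "finite B" "independent B" "span B = bs_space V"
    and NVnorm: "is_norm_on (span B) NV"
    using class_K_basis[OF V] by (auto simp: B_def NV_def)
  have NV0: "0 \<le> NV x" if "x \<in> span B" for x using NVnorm that by (auto simp: is_norm_on_def)
  have NVpos: "0 < NV x" if "x \<in> span B" "x \<noteq> 0" for x
    using NVnorm that NV0[OF that(1)] by (auto simp: is_norm_on_def less_le)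
  have NVtri: "NV (x + y) \<le> NV x + NV y" if "x \<in> span B" "y \<in> span B" for x y
    using NVnorm that by (auto simp: is_norm_on_def)
  have NVscale: "NV (c *\<^sub>R x) = \<bar>c\<bar> * NV x" if "x \<in> span B" for c x
    using NVnorm that by (auto simp: is_norm_on_def)
  obtain A0 where A0: "finite A0" "B \<subseteq> A0" "A0 \<subseteq> rational_span B"
    and A0gen: "\<And>x. x \<in> span B \<Longrightarrow>
      \<exists>c. (\<Sum>a\<in>A0. c a *\<^sub>R a) = x \<and> (\<Sum>a\<in>A0. \<bar>c a\<bar> * NV a) \<le> NV x"
    by (rule class_K_self_generated[OF V, folded B_def NV_def, folded B(3)]) (rule that)
  have BEF: "finite BE" "independent BE" "span BE \<subseteq> span BF"
    using finite_subset[OF BE BF(1)] independent_mono[OF BF(2) BE] span_mono[OF BE] by auto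
  define U where "U = BF - BE"
  have Ufin: "finite U" using BF(1) by (simp add: U_def)
  obtain u :: "'f \<Rightarrow> c00" where u: "inj_on u U" "u ` U \<inter> B = {}" "independent (B \<union> u ` U)"
    using fresh_independent_vectors[OF B(1,2) Ufin] by blast
  define C where "C = u ` U"
  have BC: "finite (B \<union> C)" "independent (B \<union> C)"
    using B(1) Ufin u(3) by (auto simp: C_def)
  obtain S where S: "linear S" "\<forall>b\<in>BF. S b = (if b \<in> BE then T b else u b)"
    using linear_independent_extend[OF BF(2), of "\<lambda>b. if b \<in> BE then T b else u b"] by blast
  \<comment> \<open>The projection onto the new coordinates, read back in the original space.\<close>
  obtain P where P: "linear P" "\<forall>v\<in>B \<union> C. P v = (if v \<in> C then inv_into U u v else 0)"
    using linear_independent_extend[OF BC(2), of "\<lambda>v. if v \<in> C then inv_into U u v else 0"] by blast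
  have ST: "S x = T x" if "x \<in> span BE" for x
    using S T(1) that BE by (intro linear_eq_on[of S T x BE]) auto
  have P0: "P v = 0" if "v \<in> span B" for v
    using P that u(2) by (intro linear_eq_0_on_span[of P B v]) (auto simp: C_def)
  have TE: "T x \<in> span B" if "x \<in> span BE" for x
  proof -
    have "T ` BE \<subseteq> span B" using T(2) rational_span_subset_span by (auto simp: B_def)
    then have "span (T ` BE) \<subseteq> span B" by (rule span_minimal) simp
    then show ?thesis using that by (auto simp: linear_span_image[OF T(1)])
  qed
  \<comment> \<open>The two spaces meet only in the image of the common subspace.\<close>
  have key: "z \<in> span BE" if z: "z \<in> span BF" "S z \<in> span B" for z
  proof -
    define h where "h z = z - P (S z)" for z
    have h: "linear h"
      unfolding h_def using linear_compose[OF S(1) P(1)]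
      by (intro linear_compose_sub linear_ident) (simp add: o_def)
    have "h b \<in> span BE" if b: "b \<in> BF" for b
    proof (cases "b \<in> BE")
      case True
      then show ?thesis using P0[of "S b"] ST[of b] TE[of b] by (simp add: h_def span_base)
    next
      case False
      then have "b \<in> U" using b by (simp add: U_def)
      then have "P (u b) = b" using P(2) u(1) by (simp add: C_def)
      then show ?thesis using S(2) b False by (simp add: h_def span_zero)
    qed
    then have "h ` BF \<subseteq> span BE" by blast
    then have "span (h ` BF) \<subseteq> span BE" by (rule span_minimal) simp
    then have "h z \<in> span BE" using z(1) by (auto simp: linear_span_image[OF h])
    then show ?thesis using P0[OF z(2)] by (simp add: h_def)
  qed
  have Sinj: "y = y'" if "y \<in> span BF" "y' \<in> span BF" "S y = S y'" for y y'
  proof -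
    have "S (y - y') = 0" using S(1) that(3) by (simp add: linear_diff)
    then have "y - y' \<in> span BE" and "T (y - y') = 0"
      using key[of "y - y'"] ST[of "y - y'"] that(1,2) by (auto simp: span_diff span_zero)
    then have "(1 - \<delta>) * norm (y - y') \<le> NV 0" using Tge[of "y - y'"] by (simp add: NV_def)
    moreover have "NV 0 = 0" using NVscale[OF span_zero, of 0] by simp
    ultimately have "norm (y - y') \<le> 0" using \<delta>(2)
      by (metis diff_gt_0_iff_gt mult_le_0_iff not_le)
    then show ?thesis by simp
  qed
  obtain Y where Y: "finite Y" "BF \<subseteq> Y" "Y \<subseteq> rational_span BF"
    and Ygen: "\<And>z. z \<in> span BF \<Longrightarrow>
      \<exists>c. (\<Sum>y\<in>Y. c y *\<^sub>R y) = z \<and> (\<Sum>y\<in>Y. \<bar>c y\<bar> * norm y) \<le> (1 + \<delta>) * norm z"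
    using finite_rational_generators[OF BF \<delta>(1)] by blast
  have Yspan: "y \<in> span BF" if "y \<in> Y" for y using that Y(3) rational_span_subset_span by blast
  \<comment> \<open>A rational number fits between the two bounds because of the slack between the factors.\<close>
  have "\<exists>q\<in>\<rat>. (1 + \<delta>) * norm y \<le> q \<and> q \<le> (1 + 2 * \<delta>) * norm y" for y :: 'f
  proof (cases "y = 0")
    case False
    then have "(1 + \<delta>) * norm y < (1 + 2 * \<delta>) * norm y" using \<delta>(1) by simp
    then show ?thesis using Rats_dense_in_real less_imp_le by blast
  qed (auto intro: bexI[of _ 0])
  then obtain q where q: "\<And>y::'f. q y \<in> \<rat>" "\<And>y. (1 + \<delta>) * norm y \<le> q y"
    "\<And>y. q y \<le> (1 + 2 * \<delta>) * norm y" by metis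
  \<comment> \<open>A generator that happens to lie in the old space takes its old norm as weight. This settles
    conflicts where the two sets of generators overlap, and by the expansion bound on \<open>T\<close> it
    stays below the weight that the generator would receive otherwise.\<close>
  define A where "A = A0 \<union> S ` Y"
  define w where "w v = (if v \<in> span B then NV v else q (inv_into Y S v))" for v
  have Afin: "finite A" using A0(1) Y(1) by (simp add: A_def)
  have A0span: "a \<in> span B" if "a \<in> A0" for a using that A0(3) rational_span_subset_span by blast
  have Sinv: "inv_into Y S (S y) = y" if "y \<in> Y" for y
  proof -
    have "inj_on S Y" using Sinj Yspan by (auto simp: inj_on_def)
    then show ?thesis using that by simp
  qed
  have Arat: "A \<subseteq> rational_span (B \<union> C)"
  proof -
    have 1: "rational_span B \<subseteq> rational_span (B \<union> C)" by (rule rational_span_mono[OF BC(1)]) simp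
    have "S b \<in> rational_span (B \<union> C)" if "b \<in> BF" for b
    proof (cases "b \<in> BE")
      case True
      then show ?thesis using S(2) that T(2) 1 by (auto simp: B_def)
    next
      case False
      then have "S b \<in> C" using S(2) that by (auto simp: C_def U_def)
      then show ?thesis using rational_span_base[OF BC(1)] by blast
    qed
    then have "S y \<in> rational_span (B \<union> C)" if "y \<in> Y" for y
      using rational_linear_image[OF S(1), of BF "B \<union> C" y] Y(3) that by blast
    then show ?thesis using A0(3) 1 by (auto simp: A_def)
  qed
  have CA: "B \<union> C \<subseteq> A"
  proof -
    have "u b \<in> S ` Y" if "b \<in> U" for b
      using that S(2) Y(2) by (intro image_eqI[of _ S b]) (auto simp: U_def)
    then show ?thesis using A0(2) by (auto simp: A_def C_def)
  qed
  have outside: "\<exists>y\<in>Y. v = S y \<and> w v = q y \<and> y \<noteq> 0" if "v \<in> A" "v \<notin> span B" for v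
  proof -
    have "v \<in> S ` Y" using that A0span unfolding A_def by blast
    then obtain y where y: "y \<in> Y" "v = S y" by blast
    have "y \<noteq> 0" using that(2) y(2) S(1) by (auto simp: linear_0 span_zero)
    with y show ?thesis using that(2) Sinv by (auto simp: w_def)
  qed
  have wpos: "0 < w v" if v: "v \<in> A" "v \<noteq> 0" for v
  proof (cases "v \<in> span B")
    case True
    then show ?thesis using NVpos that(2) by (simp add: w_def)
  next
    case False
    then obtain y where "w v = q y" "y \<noteq> 0" using outside v(1) by blast
    moreover have "0 < (1 + \<delta>) * norm y" using \<open>y \<noteq> 0\<close> \<delta>(1) by simp
    ultimately show ?thesis using q(2)[of y] by linarith
  qed
  have w0: "0 \<le> w v" if "v \<in> A" for v
  proof (cases "v = 0")
    case True
    then show ?thesis using NV0[OF span_zero] by (simp add: w_def span_zero)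
  next
    case False
    then show ?thesis using wpos that less_imp_le by blast
  qed
  have wrat: "w v \<in> \<rat>" if v: "v \<in> A" for v
  proof (cases "v \<in> span B")
    case True
    \<comment> \<open>A rational vector over the enlarged basis that lies in the span of the old basis is
      rational over the old basis.\<close>
    have "representation (B \<union> C) v b \<in> \<rat>" for b
      using representation_rational_span[OF BC] Arat v by blast
    then have "representation B v b \<in> \<rat>" for b
      using representation_extend[OF BC(2) True] by simp
    moreover have "v = (\<Sum>b\<in>B. representation B v b *\<^sub>R b)"
      using sum_representation_eq[OF B(2) True B(1)] by simp
    ultimately have "v \<in> rational_span (bs_basis V)"
      unfolding B_def by (intro rational_spanI) auto
    then show ?thesis using class_K_norm_rational[OF V] True by (simp add: w_def NV_def)
  next
    case False
    then show ?thesis using outside[OF v] q(1) by auto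
  qed
  have wS: "w (S y) \<le> (1 + 2 * \<delta>) * norm y" if y: "y \<in> Y" for y
  proof (cases "S y \<in> span B")
    case True
    then have yE: "y \<in> span BE" using key Yspan[OF y] by blast
    then have "w (S y) \<le> (1 + \<delta>) * norm y" using True Tle[OF yE] ST by (simp add: w_def NV_def)
    also have "\<dots> \<le> (1 + 2 * \<delta>) * norm y" using \<delta>(1) by (intro mult_right_mono) auto
    finally show ?thesis .
  next
    case False
    then show ?thesis using q(3) y Sinv by (simp add: w_def)
  qed
  define N where "N = induced_norm A w"
  define W where "W = \<lparr>bs_space = span (B \<union> C), bs_norm = N, bs_basis = B \<union> C\<rparr>"
  have WK: "W \<in> class_K"
    unfolding W_def N_def using class_K_induced_norm[OF BC Afin CA Arat, of w] w0 wpos wrat by blast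
  have spanA: "span (B \<union> C) \<subseteq> span A" by (rule span_mono[OF CA])
  \<comment> \<open>The norm dominates the norm of the push-out of the old space and the given one.\<close>
  have decomp: "\<exists>x\<in>span B. \<exists>y\<in>span BF. v = x + S y \<and> NV x + (1 + \<delta>) * norm y \<le> N v"
    if v: "v \<in> span A" for v
  proof -
    obtain c where c: "(\<Sum>a\<in>A. c a *\<^sub>R a) = v" "N v = (\<Sum>a\<in>A. \<bar>c a\<bar> * w a)"
      unfolding N_def using induced_norm_attained_combination[of A w v, OF Afin w0 v] by blast
    have "\<exists>x\<in>span B. \<exists>y\<in>span BF. (\<Sum>a\<in>I. c a *\<^sub>R a) = x + S y \<and>
        NV x + (1 + \<delta>) * norm y \<le> (\<Sum>a\<in>I. \<bar>c a\<bar> * w a)" if "I \<subseteq> A" for I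
      using finite_subset[OF that Afin] that
    proof (induction I rule: finite_induct)
      case empty
      have "NV 0 = 0" using NVscale[OF span_zero, of 0] by simp
      then show ?case using span_zero[of B] span_zero[of BF] linear_0[OF S(1)]
        by (intro bexI[of _ 0]) simp_all
    next
      case (insert a I)
      then obtain x y where xy: "x \<in> span B" "y \<in> span BF" "(\<Sum>a\<in>I. c a *\<^sub>R a) = x + S y"
        "NV x + (1 + \<delta>) * norm y \<le> (\<Sum>a\<in>I. \<bar>c a\<bar> * w a)" by auto
      have sum: "(\<Sum>a\<in>insert a I. c a *\<^sub>R a) = c a *\<^sub>R a + (x + S y)"
        "(\<Sum>a\<in>insert a I. \<bar>c a\<bar> * w a) = \<bar>c a\<bar> * w a + (\<Sum>a\<in>I. \<bar>c a\<bar> * w a)"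
        using insert.hyps xy(3) by simp_all
      show ?case
      proof (cases "a \<in> span B")
        case True
        have "NV (c a *\<^sub>R a + x) \<le> \<bar>c a\<bar> * w a + NV x"
          using NVtri[OF span_scale[OF True] xy(1)] NVscale[OF True] True by (simp add: w_def)
        then show ?thesis unfolding sum using xy True
          by (intro bexI[of _ "c a *\<^sub>R a + x"] bexI[of _ y]) (auto simp: span_add span_scale)
      next
        case False
        then obtain z where z: "z \<in> Y" "a = S z" "w a = q z" using outside insert.prems by blast
        have "(1 + \<delta>) * norm (c a *\<^sub>R z + y) \<le> (1 + \<delta>) * (\<bar>c a\<bar> * norm z + norm y)"
          using norm_triangle_ineq[of "c a *\<^sub>R z" y] \<delta>(1) by (intro mult_left_mono) auto
        also have "\<dots> = \<bar>c a\<bar> * ((1 + \<delta>) * norm z) + (1 + \<delta>) * norm y" by (simp add: algebra_simps)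
        also have "\<dots> \<le> \<bar>c a\<bar> * w a + (1 + \<delta>) * norm y"
          using q(2)[of z] z(3) by (simp add: mult_left_mono)
        finally have "NV x + (1 + \<delta>) * norm (c a *\<^sub>R z + y) \<le> (\<Sum>a\<in>insert a I. \<bar>c a\<bar> * w a)"
          using xy(4) sum(2) by simp
        moreover have "(\<Sum>a\<in>insert a I. c a *\<^sub>R a) = x + S (c a *\<^sub>R z + y)"
          using sum(1) z(2) S(1) by (simp add: linear_add linear_scale)
        moreover have "c a *\<^sub>R z + y \<in> span BF"
          using Yspan[OF z(1)] xy(2) by (simp add: span_add span_scale)
        ultimately show ?thesis using xy(1) by blast
      qed
    qed
    from this[OF order_refl] show ?thesis using c by simp
  qed
  have NB: "N x = NV x" if x: "x \<in> span B" for x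
  proof (rule antisym)
    obtain c where c: "(\<Sum>a\<in>A0. c a *\<^sub>R a) = x" "(\<Sum>a\<in>A0. \<bar>c a\<bar> * NV a) \<le> NV x"
      using A0gen[OF x] by blast
    have "N x \<le> (\<Sum>a\<in>A0. \<bar>c a\<bar> * N a)"
      unfolding N_def c(1)[symmetric]
      by (rule induced_norm_sum_le[of A w, OF Afin w0]) (auto simp: A_def intro: span_base)
    also have "\<dots> \<le> (\<Sum>a\<in>A0. \<bar>c a\<bar> * NV a)"
    proof (intro sum_mono mult_left_mono)
      fix a assume a: "a \<in> A0"
      then show "N a \<le> NV a"
        using induced_norm_generator_le[of A w a, OF Afin w0] A0span[OF a]
        by (simp add: A_def N_def w_def)
    qed simp
    finally show "N x \<le> NV x" using c(2) by simp
    have "x \<in> span A" using x spanA span_mono[of B "B \<union> C"] by blast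
    then obtain x' y where xy: "x' \<in> span B" "y \<in> span BF" "x = x' + S y"
      "NV x' + (1 + \<delta>) * norm y \<le> N x" using decomp by blast
    have "S y \<in> span B" using xy(3) span_diff[OF x xy(1)] by simp
    then have y: "y \<in> span BE" using key xy(2) by blast
    have "NV x \<le> NV x' + NV (S y)" unfolding xy(3) using xy(1) \<open>S y \<in> span B\<close> by (rule NVtri)
    also have "NV (S y) \<le> (1 + \<delta>) * norm y" using Tle[OF y] ST[OF y] by (simp add: NV_def)
    finally show "NV x \<le> N x" using xy(4) by simp
  qed
  have Sspan: "S z \<in> span (B \<union> C)" if "z \<in> span BF" for z
  proof -
    have "S ` BF \<subseteq> A" using Y(2) by (auto simp: A_def)
    then have "S ` BF \<subseteq> span (B \<union> C)" using Arat rational_span_subset_span by blast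
    then have "span (S ` BF) \<subseteq> span (B \<union> C)" by (rule span_minimal) simp
    then show ?thesis using that by (auto simp: linear_span_image[OF S(1)])
  qed
  show thesis
  proof (rule that[of W S])
    show "(\<lambda>x. x) \<in> class_E V W"
      using NB span_mono[of B "B \<union> C"] unfolding class_E_def W_def B(3)[symmetric]
      by (auto simp: linear_map_on_def NV_def B_def[symmetric])
    show "S b = T b" if "b \<in> BE" for b using S(2) that BE by auto
    show "S z \<in> bs_space W" if "z \<in> span BF" for z using Sspan[OF that] by (simp add: W_def)
    show "(1 - \<delta>) * norm z \<le> bs_norm W (S z)" if z: "z \<in> span BF" for z
    proof -
      obtain x y where xy: "x \<in> span B" "y \<in> span BF" "S z = x + S y"
        "NV x + (1 + \<delta>) * norm y \<le> N (S z)" using decomp[of "S z"] Sspan[OF z] spanA by blast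
      have Sx: "S (z - y) = x" using xy(3) S(1) by (simp add: linear_diff)
      then have zy: "z - y \<in> span BE" using key[of "z - y"] z xy(1,2) by (simp add: span_diff)
      have "(1 - \<delta>) * norm (z - y) \<le> NV x" using Tge[OF zy] ST[OF zy] Sx by (simp add: NV_def)
      moreover have "(1 - \<delta>) * norm z \<le> (1 - \<delta>) * (norm (z - y) + norm y)"
        using norm_triangle_ineq[of "z - y" y] \<delta>(2) by (intro mult_left_mono) auto
      moreover have "(1 - \<delta>) * norm y \<le> (1 + \<delta>) * norm y"
        using \<delta>(1) by (intro mult_right_mono) auto
      ultimately have "(1 - \<delta>) * norm z \<le> N (S z)" using xy(4) by (simp add: distrib_left)
      then show ?thesis by (simp add: W_def)
    qed
    show "bs_norm W (S z) \<le> (1 + 2 * \<delta>) * (1 + \<delta>) * norm z" if z: "z \<in> span BF" for z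
    proof -
      obtain c where c: "(\<Sum>y\<in>Y. c y *\<^sub>R y) = z" "(\<Sum>y\<in>Y. \<bar>c y\<bar> * norm y) \<le> (1 + \<delta>) * norm z"
        using Ygen[OF z] by blast
      have "S z = (\<Sum>y\<in>Y. c y *\<^sub>R S y)"
        unfolding c(1)[symmetric] using S(1) by (simp add: linear_sum linear_scale)
      then have "N (S z) \<le> (\<Sum>y\<in>Y. \<bar>c y\<bar> * N (S y))"
        unfolding N_def
        using induced_norm_sum_le[of A w Y S c, OF Afin w0] by (simp add: A_def span_base)
      also have "\<dots> \<le> (\<Sum>y\<in>Y. \<bar>c y\<bar> * ((1 + 2 * \<delta>) * norm y))"
      proof (intro sum_mono mult_left_mono)
        fix y assume y: "y \<in> Y"
        have "N (S y) \<le> w (S y)"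
          unfolding N_def using y by (intro induced_norm_generator_le[of A w, OF Afin w0])
            (auto simp: A_def)
        then show "N (S y) \<le> (1 + 2 * \<delta>) * norm y" using wS[OF y] by linarith
      qed simp
      also have "\<dots> = (1 + 2 * \<delta>) * (\<Sum>y\<in>Y. \<bar>c y\<bar> * norm y)"
        by (simp add: sum_distrib_left mult_ac)
      also have "\<dots> \<le> (1 + 2 * \<delta>) * ((1 + \<delta>) * norm z)"
        using c(2) \<delta>(1) by (intro mult_left_mono) auto
      finally show ?thesis by (simp add: W_def mult.assoc)
    qed
  qed (use WK S(1) in auto)
qed

section \<open>Rational vectors in the limit\<close>

lemma countable_rational_span:
  assumes "finite B" shows "countable (rational_span B)"
proof -
  have "rational_span B \<subseteq> (\<lambda>q. \<Sum>b\<in>B. q b *\<^sub>R b) ` (PiE B (\<lambda>_. \<rat>))"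
  proof
    fix x assume "x \<in> rational_span B"
    then obtain q where q: "\<And>b. b \<in> B \<Longrightarrow> q b \<in> \<rat>" "x = (\<Sum>b\<in>B. q b *\<^sub>R b)"
      by (blast elim: rational_spanE)
    then show "x \<in> (\<lambda>q. \<Sum>b\<in>B. q b *\<^sub>R b) ` (PiE B (\<lambda>_. \<rat>))"
      by (intro image_eqI[of _ _ "restrict q B"]) auto
  qed
  moreover have "countable (PiE B (\<lambda>_. \<rat> :: real set))"
    using assms countable_rat by (intro countable_PiE)
  ultimately show ?thesis by (meson countable_image countable_subset)
qed

lemma rational_span_dense:
  fixes g :: "'a::real_vector \<Rightarrow> 'b::real_normed_vector"
  assumes B: "finite B" and g: "linear g" and x: "x \<in> span B" and e: "0 < e"
  shows "\<exists>x'\<in>rational_span B. norm (g x' - g x) < e"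
proof -
  obtain r where r: "(\<Sum>b\<in>B. r b *\<^sub>R b) = x" using span_finiteE[OF B x] by blast
  define s where "s = (\<Sum>b\<in>B. norm (g b)) + 1"
  have s: "0 < s" by (simp add: s_def sum_nonneg add_nonneg_pos)
  have "\<exists>q\<in>\<rat>. \<bar>q - t\<bar> < e / s" for t
  proof -
    obtain q where "q \<in> \<rat>" "t < q" "q < t + e / s"
      using Rats_dense_in_real[of t "t + e / s"] e s by auto
    then show ?thesis by (intro bexI[of _ q]) auto
  qed
  then obtain q where q: "\<And>t. q t \<in> \<rat>" "\<And>t. \<bar>q t - t\<bar> < e / s" by metis
  define x' where "x' = (\<Sum>b\<in>B. q (r b) *\<^sub>R b)"
  have "g x' - g x = (\<Sum>b\<in>B. (q (r b) - r b) *\<^sub>R g b)"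
    unfolding x'_def r[symmetric] using g
    by (simp add: linear_sum linear_scale scaleR_left_diff_distrib sum_subtractf)
  then have "norm (g x' - g x) \<le> (\<Sum>b\<in>B. norm ((q (r b) - r b) *\<^sub>R g b))"
    by (simp only: norm_sum)
  also have "\<dots> \<le> (\<Sum>b\<in>B. (e / s) * norm (g b))"
    unfolding norm_scaleR using q(2) by (intro sum_mono mult_right_mono) (auto intro: less_imp_le)
  also have "\<dots> = (e / s) * (\<Sum>b\<in>B. norm (g b))" by (rule sum_distrib_left[symmetric])
  also have "\<dots> < (e / s) * s" using e s by (intro mult_strict_left_mono) (auto simp: s_def)
  finally have "norm (g x' - g x) < e" using s by simp
  moreover have "x' \<in> rational_span B" using q(1) by (intro rational_spanI) (auto simp: x'_def)
  ultimately show ?thesis by blast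
qed

lemma class_E_rational:
  assumes "V \<in> class_K" "W \<in> class_K" "f \<in> class_E V W" "x \<in> rational_span (bs_basis V)"
  shows "f x \<in> rational_span (bs_basis W)"
proof -
  note BV = class_K_basis[OF assms(1)] and BW = class_K_basis[OF assms(2)]
  have f: "linear_map_on (span (bs_basis V)) f" "f ` bs_basis V \<subseteq> bs_basis W"
    using assms(3) BV(3) by (auto simp: class_E_def)
  obtain g where g: "linear g" "\<And>x. x \<in> span (bs_basis V) \<Longrightarrow> g x = f x"
    using linear_extension_from_span[OF BV(2) f(1)] by blast
  have "g b \<in> rational_span (bs_basis W)" if "b \<in> bs_basis V" for b
    using g(2)[OF span_base[OF that]] f(2) that rational_span_base[OF BW(1)] by auto
  then have "g x \<in> rational_span (bs_basis W)"
    by (rule rational_linear_image[OF g(1) _ assms(4)])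
  then show ?thesis using g(2)[of x] assms(4) rational_span_subset_span by force
qed

text \<open>Rational vectors are dense in each stage, the stages exhaust the limit, and the limit is
  dense in its completion. As each stage has only countably many rational vectors, this gives
  separability, and it also allows moving a finite dimensional subspace of the completion
  into a single stage with rational coordinates.\<close>

lemma rational_vectors_dense_in_completion:
  assumes X: "\<And>n. X n \<in> class_K" and lim: "is_direct_limit X f j"
    and \<kappa>: "is_completion \<kappa>" and e: "0 < e"
  shows "\<exists>n. \<exists>x\<in>rational_span (bs_basis (X n)). norm (\<kappa> (j n x) - y) < e"
proof -
  have "y \<in> closure (range \<kappa>)" using \<kappa> by (simp add: is_completion_def)
  then obtain g where g: "dist (\<kappa> g) y < e / 2"
    using e by (metis closure_approachable half_gt_zero rangeE)
  obtain n x where x: "x \<in> bs_space (X n)" "g = j n x"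
    using lim unfolding is_direct_limit_def by blast
  note B = class_K_basis[OF X[of n]]
  obtain J where J: "linear J" "\<And>x. x \<in> span (bs_basis (X n)) \<Longrightarrow> J x = j n x"
    using linear_extension_from_span[OF B(2), of "j n"] lim B(3) by (auto simp: is_direct_limit_def)
  obtain x' where x': "x' \<in> rational_span (bs_basis (X n))" "norm (J x' - J x) < e / 2"
    using rational_span_dense[OF B(1) J(1), of x "e / 2"] x(1) B(3) e by auto
  have "j n x' = J x'" "j n x = J x"
    using J(2) x(1) B(3) x'(1) rational_span_subset_span by force+
  moreover have "norm (\<kappa> (J x') - \<kappa> (J x)) = norm (J x' - J x)"
    using \<kappa> unfolding is_completion_def by (metis linear_diff)
  ultimately have "norm (\<kappa> (j n x') - \<kappa> g) < e / 2" using x'(2) x(2) by simp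
  then have "norm (\<kappa> (j n x') - y) < e"
    using g norm_triangle_ineq[of "\<kappa> (j n x') - \<kappa> g" "\<kappa> g - y"] by (simp add: dist_norm)
  with x'(1) show ?thesis by blast
qed

lemma rational_vector_later_stage:
  assumes X: "\<And>n. X n \<in> class_K" and f: "\<And>n. f n \<in> class_E (X n) (X (Suc n))"
    and lim: "is_direct_limit X f j" and x: "x \<in> rational_span (bs_basis (X n))" and "n \<le> m"
  shows "\<exists>x'\<in>rational_span (bs_basis (X m)). j m x' = j n x"
  using \<open>n \<le> m\<close>
proof (induction m rule: dec_induct)
  case base
  show ?case using x by blast
next
  case (step m)
  then obtain x' where x': "x' \<in> rational_span (bs_basis (X m))" "j m x' = j n x" by blast
  have "x' \<in> bs_space (X m)"
    using x'(1) rational_span_subset_span class_K_basis(3)[OF X] by blast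
  then have "j (Suc m) (f m x') = j n x" using lim x'(2) by (simp add: is_direct_limit_def)
  then show ?case using class_E_rational[OF X X f x'(1)] by blast
qed

lemma separable_completion:
  fixes \<kappa> :: "'g::real_normed_vector \<Rightarrow> 'c::banach" and j :: "nat \<Rightarrow> 'a::real_vector \<Rightarrow> 'g"
  assumes X: "\<And>n. X n \<in> class_K" and lim: "is_direct_limit X f j" and \<kappa>: "is_completion \<kappa>"
  shows "separable_space (euclidean :: 'c topology)"
proof -
  define D where "D = (\<Union>n. (\<lambda>x. \<kappa> (j n x)) ` rational_span (bs_basis (X n)))"
  have "countable D"
    unfolding D_def
    by (intro countable_UN countable_image countable_rational_span class_K_basis(1)[OF X]) simp
  moreover have "y \<in> closure D" for y
    unfolding closure_approachable
  proof (intro allI impI)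
    fix e :: real assume "0 < e"
    then obtain n x where "x \<in> rational_span (bs_basis (X n))" "norm (\<kappa> (j n x) - y) < e"
      using rational_vectors_dense_in_completion[OF X lim \<kappa>] by blast
    then show "\<exists>z\<in>D. dist z y < e"
      by (intro bexI[of _ "\<kappa> (j n x)"]) (auto simp: D_def dist_norm)
  qed
  ultimately show ?thesis unfolding separable_space_def by (intro exI[of _ D]) auto
qed

text \<open>One common stage suffices because the connecting maps send basis elements to basis elements,
  so a rational vector stays rational at all later stages.\<close>

lemma rational_approximation_in_one_stage:
  assumes X: "\<And>n. X n \<in> class_K" and f: "\<And>n. f n \<in> class_E (X n) (X (Suc n))"
    and lim: "is_direct_limit X f j" and \<kappa>: "is_completion \<kappa>" and S: "finite S" and e: "0 < e"
  shows "\<exists>n t. \<forall>s\<in>S. t s \<in> rational_span (bs_basis (X n)) \<and> norm (\<kappa> (j n (t s)) - \<phi> s) < e"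
  using S
proof (induction S rule: finite_induct)
  case (insert s S)
  then obtain n t where t: "\<forall>s\<in>S. t s \<in> rational_span (bs_basis (X n)) \<and>
    norm (\<kappa> (j n (t s)) - \<phi> s) < e" by blast
  obtain m x where x: "x \<in> rational_span (bs_basis (X m))" "norm (\<kappa> (j m x) - \<phi> s) < e"
    using rational_vectors_dense_in_completion[OF X lim \<kappa> e] by blast
  let ?k = "max n m"
  have "\<exists>y\<in>rational_span (bs_basis (X ?k)). norm (\<kappa> (j ?k y) - \<phi> s') < e" if "s' \<in> insert s S" for s'
  proof (cases "s' = s")
    case True
    then show ?thesis
      using rational_vector_later_stage[OF X f lim x(1), of ?k] x(2) by (metis max.cobounded2)
  next
    case False
    then have s': "s' \<in> S" using that by simp
    then show ?thesis
      using rational_vector_later_stage[OF X f lim, of "t s'" n ?k] t by (metis max.cobounded1)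
  qed
  then show ?case by metis
qed simp

section \<open>The completion is the Gurarij space\<close>

theorem theorem3p14:
  fixes X :: "nat \<Rightarrow> c00 based_space"
    and f :: "nat \<Rightarrow> c00 \<Rightarrow> c00"
    and j :: "nat \<Rightarrow> c00 \<Rightarrow> 'g::real_normed_vector"
    and \<kappa> :: "'g \<Rightarrow> 'c::banach"
  assumes "is_fraisse_limit X f j"
    and "is_completion \<kappa>"
  shows "separable_space (euclidean :: 'c topology) \<and>
    (\<forall>\<epsilon>>0. \<forall>(E :: 'f::real_normed_vector set) F. \<forall>\<phi> :: 'f \<Rightarrow> 'c.
       subspace E \<and> subspace F \<and> (\<exists>S. finite S \<and> span S = F) \<and> E \<subseteq> F \<and>
       linear_map_on E \<phi> \<and> (\<forall>x\<in>E. norm (\<phi> x) = norm x) \<longrightarrow>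
       (\<exists>\<psi> :: 'f \<Rightarrow> 'c. linear_map_on F \<psi> \<and> (\<forall>x\<in>E. \<psi> x = \<phi> x) \<and>
          (\<forall>x\<in>F. (1 - \<epsilon>) * norm x \<le> norm (\<psi> x) \<and> norm (\<psi> x) \<le> (1 + \<epsilon>) * norm x)))"
proof (intro conjI allI impI; (elim conjE)?)
  have X: "X n \<in> class_K" and f: "f n \<in> class_E (X n) (X (Suc n))" for n
    using assms(1) by (simp_all add: is_fraisse_limit_def)
  have lim: "is_direct_limit X f j" using assms(1) by (simp add: is_fraisse_limit_def)
  have \<kappa>: "linear \<kappa>" "\<And>x. norm (\<kappa> x) = norm x"
    using assms(2) by (auto simp: is_completion_def)
  show "separable_space (euclidean :: 'c topology)"
    by (rule separable_completion[OF X lim assms(2)])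
  fix \<epsilon> :: real and E F :: "'f set" and \<phi> :: "'f \<Rightarrow> 'c"
  assume \<epsilon>: "0 < \<epsilon>" and E: "subspace E" and F: "subspace F"
    and Ffin: "\<exists>S. finite S \<and> span S = F" and EF: "E \<subseteq> F"
    and \<phi>: "linear_map_on E \<phi>" "\<forall>x\<in>E. norm (\<phi> x) = norm x"
  obtain BE where BE: "BE \<subseteq> E" "independent BE" "E \<subseteq> span BE"
    using maximal_independent_subset[of E] by blast
  obtain BF where BF: "BE \<subseteq> BF" "BF \<subseteq> F" "independent BF" "F \<subseteq> span BF"
    using maximal_independent_subset_extend[of BE F] BE EF by blast
  have "finite BF" using Ffin BF(2,3) independent_span_bound by blast
  then have fin: "finite BF" "finite BE" using BF(1) finite_subset by auto
  have Espan: "span BE = E" and Fspan: "span BF = F"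
    using span_minimal[OF BE(1) E] BE(3) span_minimal[OF BF(2) F] BF(4) by auto
  obtain \<Phi> where \<Phi>: "linear \<Phi>" "\<And>x. x \<in> E \<Longrightarrow> \<Phi> x = \<phi> x"
    using linear_extension_from_span[OF BE(2), of \<phi>] \<phi>(1) Espan by auto
  \<comment> \<open>The amalgam distorts by \<open>1 - \<delta>\<close> from below and \<open>(1 + 2 * \<delta>) * (1 + \<delta>)\<close> from above, and the final
    correction costs another \<open>\<delta>\<close>.\<close>
  define \<delta> where "\<delta> = min \<epsilon> 1 / 8"
  have \<delta>: "0 < \<delta>" "\<delta> < 1" "2 * \<delta> \<le> \<epsilon>" "(1 + 2 * \<delta>) * (1 + \<delta>) + \<delta> \<le> 1 + \<epsilon>"
  proof -
    show "0 < \<delta>" "\<delta> < 1" "2 * \<delta> \<le> \<epsilon>" using \<epsilon> by (auto simp: \<delta>_def)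
    have "\<delta> * \<delta> \<le> \<delta> * 1" using \<open>0 < \<delta>\<close> \<open>\<delta> < 1\<close> by (intro mult_left_mono) auto
    moreover have "8 * \<delta> \<le> \<epsilon>" by (simp add: \<delta>_def)
    moreover have "(1 + 2 * \<delta>) * (1 + \<delta>) + \<delta> = 1 + 4 * \<delta> + 2 * (\<delta> * \<delta>)" by (simp add: algebra_simps)
    ultimately show "(1 + 2 * \<delta>) * (1 + \<delta>) + \<delta> \<le> 1 + \<epsilon>" using \<open>0 < \<delta>\<close> by linarith
  qed
  obtain \<eta>1 where \<eta>1: "0 < \<eta>1" "\<forall>h :: 'f \<Rightarrow> 'c. linear h \<longrightarrow> (\<forall>b\<in>BE. norm (h b) \<le> \<eta>1) \<longrightarrow>
    (\<forall>x\<in>E. norm (h x) \<le> \<delta> * norm x)"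
    using linear_small_of_small_on_basis[OF fin(2) BE(2) \<delta>(1)] unfolding Espan by blast
  obtain \<eta>2 where \<eta>2: "0 < \<eta>2" "\<forall>h :: 'f \<Rightarrow> 'c. linear h \<longrightarrow> (\<forall>b\<in>BF. norm (h b) \<le> \<eta>2) \<longrightarrow>
    (\<forall>x\<in>F. norm (h x) \<le> \<delta> * norm x)"
    using linear_small_of_small_on_basis[OF fin(1) BF(3) \<delta>(1)] unfolding Fspan by blast
  define \<eta> where "\<eta> = min \<eta>1 \<eta>2"
  have \<eta>: "0 < \<eta>" "\<eta> \<le> \<eta>1" "\<eta> \<le> \<eta>2" using \<eta>1(1) \<eta>2(1) by (auto simp: \<eta>_def)
  obtain n t where t: "\<And>b. b \<in> BE \<Longrightarrow> t b \<in> rational_span (bs_basis (X n))"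
    "\<And>b. b \<in> BE \<Longrightarrow> norm (\<kappa> (j n (t b)) - \<phi> b) < \<eta>"
    using rational_approximation_in_one_stage[OF X f lim assms(2) fin(2) \<eta>(1), of \<phi>] by blast
  define V where "V = X n"
  have VK: "V \<in> class_K" using X by (simp add: V_def)
  note B = class_K_basis[OF VK]
  have jlin: "linear_map_on (bs_space V) (j n)"
    and jnorm: "\<And>x. x \<in> bs_space V \<Longrightarrow> norm (j n x) = bs_norm V x"
    using lim by (auto simp: is_direct_limit_def V_def)
  obtain J where J: "linear J" "\<And>x. x \<in> bs_space V \<Longrightarrow> J x = j n x"
    using linear_extension_from_span[OF B(2), of "j n"] jlin B(3) by auto
  obtain T where T: "linear T" "\<forall>b\<in>BE. T b = t b"
    using linear_independent_extend[OF BE(2), of t] by blast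
  have tV: "t b \<in> bs_space V" if "b \<in> BE" for b
    using t(1)[OF that] rational_span_subset_span B(3) by (auto simp: V_def)
  have TV: "T x \<in> bs_space V" if "x \<in> E" for x
  proof -
    have "T ` BE \<subseteq> span (bs_basis V)" using tV T(2) B(3) by auto
    then have "span (T ` BE) \<subseteq> span (bs_basis V)" by (rule span_minimal) simp
    then show ?thesis using that B(3) by (auto simp: linear_span_image[OF T(1)] Espan)
  qed
  have Tdist: "\<bar>bs_norm V (T x) - norm x\<bar> \<le> \<delta> * norm x" if x: "x \<in> E" for x
  proof -
    define h where "h x = \<kappa> (J (T x)) - \<Phi> x" for x
    have "linear h"
      unfolding h_def using linear_compose[OF linear_compose[OF T(1) J(1)] \<kappa>(1)] \<Phi>(1)
      by (intro linear_compose_sub) (simp_all add: o_def)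
    moreover have "norm (h b) \<le> \<eta>1" if b: "b \<in> BE" for b
    proof -
      have "h b = \<kappa> (j n (t b)) - \<phi> b" using b BE(1) tV T(2) J(2) \<Phi>(2) by (auto simp: h_def)
      then show ?thesis using t(2)[OF b] \<eta>(2) by simp
    qed
    ultimately have "norm (h x) \<le> \<delta> * norm x" using \<eta>1(2) x by blast
    moreover have "norm (\<kappa> (J (T x))) = bs_norm V (T x)"
      using \<kappa>(2) J(2) TV[OF x] jnorm by simp
    moreover have "norm (\<Phi> x) = norm x" using \<Phi>(2) \<phi>(2) x by simp
    moreover have "\<bar>norm (\<kappa> (J (T x))) - norm (\<Phi> x)\<bar> \<le> norm (h x)"
      unfolding h_def by (rule norm_triangle_ineq3)
    ultimately show ?thesis by linarith
  qed
  have Tb: "T b \<in> rational_span (bs_basis V)" if "b \<in> BE" for b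
    using t(1) T(2) that by (simp add: V_def)
  have Tle: "bs_norm V (T x) \<le> (1 + \<delta>) * norm x" and Tge: "(1 - \<delta>) * norm x \<le> bs_norm V (T x)"
    if "x \<in> span BE" for x
    using Tdist[of x] that by (auto simp: Espan algebra_simps abs_le_iff)
  obtain W S where W: "W \<in> class_K" "(\<lambda>x. x) \<in> class_E V W"
    and S: "linear S" "\<And>b. b \<in> BE \<Longrightarrow> S b = T b" "\<And>z. z \<in> span BF \<Longrightarrow> S z \<in> bs_space W"
    "\<And>z. z \<in> span BF \<Longrightarrow> (1 - \<delta>) * norm z \<le> bs_norm W (S z)"
    "\<And>z. z \<in> span BF \<Longrightarrow> bs_norm W (S z) \<le> (1 + 2 * \<delta>) * (1 + \<delta>) * norm z"
    using approximate_amalgamation[OF VK fin(1) BF(3,1) T(1) Tb \<delta>(1,2) Tle Tge] by blast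
  \<comment> \<open>The extension property of the limit, applied to the canonical map of the stage \<open>V\<close>, places
    the amalgam into the limit without moving \<open>V\<close>.\<close>
  have "(\<lambda>x. x) \<in> class_E V V" by (simp add: class_E_def linear_map_on_def)
  then have "E_into_limit X j V (j n)"
    unfolding E_into_limit_def V_def by (intro exI[of _ n] bexI[of _ "\<lambda>x. x"]) simp_all
  then obtain \<iota> where \<iota>: "E_into_limit X j W \<iota>" "\<And>x. x \<in> bs_space V \<Longrightarrow> \<iota> x = j n x"
    using assms(1) VK W unfolding is_fraisse_limit_def by blast
  obtain m e where e: "e \<in> class_E W (X m)" "\<And>x. x \<in> bs_space W \<Longrightarrow> \<iota> x = j m (e x)"
    using \<iota>(1) unfolding E_into_limit_def by blast
  note BW = class_K_basis[OF W(1)] and Bm = class_K_basis[OF X[of m]]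
  obtain I1 where I1: "linear I1" "\<And>x. x \<in> bs_space W \<Longrightarrow> I1 x = e x"
    using linear_extension_from_span[OF BW(2), of e] BW(3) e(1) by (auto simp: class_E_def)
  obtain I2 where I2: "linear I2" "\<And>x. x \<in> bs_space (X m) \<Longrightarrow> I2 x = j m x"
    using linear_extension_from_span[OF Bm(2), of "j m"] Bm(3) lim
    by (auto simp: is_direct_limit_def)
  define L where "L x = \<kappa> (I2 (I1 (S x)))" for x
  have L: "linear L"
    using linear_compose[OF linear_compose[OF linear_compose[OF S(1) I1(1)] I2(1)] \<kappa>(1)]
    by (simp add: L_def[abs_def] o_def)
  have Liota: "I2 (I1 w) = \<iota> w" if "w \<in> bs_space W" for w
  proof -
    have "e w \<in> bs_space (X m)" using e(1) that by (auto simp: class_E_def)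
    then show ?thesis using I1(2) I2(2) e(2) that by simp
  qed
  have Lnorm: "norm (L x) = bs_norm W (S x)" if "x \<in> F" for x
  proof -
    have SW: "S x \<in> bs_space W" using S(3) that Fspan by simp
    then have "e (S x) \<in> bs_space (X m)" "bs_norm (X m) (e (S x)) = bs_norm W (S x)"
      using e(1) by (auto simp: class_E_def)
    then show ?thesis
      using lim SW \<kappa>(2) I1(2) I2(2) by (simp add: L_def is_direct_limit_def)
  qed
  \<comment> \<open>The map is corrected on the basis of the subspace, where it is off by less
    than \<open>\<eta>\<close>, so that it extends the given isometry exactly.\<close>
  obtain \<psi> where \<psi>: "linear \<psi>" "\<forall>b\<in>BF. \<psi> b = (if b \<in> BE then \<phi> b else L b)"
    using linear_independent_extend[OF BF(3), of "\<lambda>b. if b \<in> BE then \<phi> b else L b"] by blast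
  have close: "norm (\<psi> x - L x) \<le> \<delta> * norm x" if x: "x \<in> F" for x
  proof -
    have "linear (\<lambda>x. \<psi> x - L x)" using \<psi>(1) L by (rule linear_compose_sub)
    moreover have "norm (\<psi> b - L b) \<le> \<eta>2" if b: "b \<in> BF" for b
    proof (cases "b \<in> BE")
      case True
      have "S b \<in> bs_space W" using S(3) b by (simp add: span_base)
      then have "L b = \<kappa> (j n (t b))"
        using Liota \<iota>(2)[OF tV[OF True]] S(2)[OF True] T(2) True by (simp add: L_def)
      then show ?thesis using t(2)[OF True] \<eta>(3) \<psi>(2) b True by (simp add: norm_minus_commute)
    next
      case False
      then show ?thesis using \<psi>(2) b \<eta>2(1) by simp
    qed
    ultimately show ?thesis using \<eta>2(2) x by blast
  qed
  show "\<exists>\<psi>. linear_map_on F \<psi> \<and> (\<forall>x\<in>E. \<psi> x = \<phi> x) \<and>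
    (\<forall>x\<in>F. (1 - \<epsilon>) * norm x \<le> norm (\<psi> x) \<and> norm (\<psi> x) \<le> (1 + \<epsilon>) * norm x)"
  proof (intro exI[of _ \<psi>] conjI ballI)
    show "linear_map_on F \<psi>" by (rule linear_map_on_linear[OF \<psi>(1)])
    show "\<psi> x = \<phi> x" if x: "x \<in> E" for x
    proof -
      have "\<psi> b = \<Phi> b" if b: "b \<in> BE" for b
      proof -
        have "b \<in> BF" "b \<in> E" using b BE(1) BF(1) by blast+
        then show ?thesis using \<psi>(2) \<Phi>(2) b by simp
      qed
      then have "\<psi> x = \<Phi> x"
        using x by (intro linear_eq_on[OF \<psi>(1) \<Phi>(1), of x BE]) (simp_all add: Espan)
      then show ?thesis using \<Phi>(2) x by simp
    qed
    fix x assume x: "x \<in> F"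
    have tri: "\<bar>norm (\<psi> x) - norm (L x)\<bar> \<le> \<delta> * norm x"
      using close[OF x] norm_triangle_ineq3[of "\<psi> x" "L x"] by linarith
    have lo: "(1 - \<delta>) * norm x \<le> norm (L x)"
      and up: "norm (L x) \<le> (1 + 2 * \<delta>) * (1 + \<delta>) * norm x"
      using S(4,5) Lnorm[OF x] x Fspan by auto
    have "(1 - \<epsilon>) * norm x \<le> (1 - \<delta> - \<delta>) * norm x" using \<delta>(3) by (intro mult_right_mono) auto
    also have "\<dots> \<le> norm (\<psi> x)" using tri lo by (simp add: algebra_simps)
    finally show "(1 - \<epsilon>) * norm x \<le> norm (\<psi> x)" .
    have "norm (\<psi> x) \<le> ((1 + 2 * \<delta>) * (1 + \<delta>) + \<delta>) * norm x"
      using tri up by (simp add: distrib_right[of _ \<delta>])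
    also have "\<dots> \<le> (1 + \<epsilon>) * norm x" using \<delta>(4) by (intro mult_right_mono) auto
    finally show "norm (\<psi> x) \<le> (1 + \<epsilon>) * norm x" .
  qed
qed

end
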